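(* Let $p\in S^1$, let $T_p$ be the stabilizer of $p$ in Thompson's group $T$, and let $\sigma$ be a finite-dimensional unitary representation of $T_p$. Then for every $s\in\mathbb{R}$ the representation $\mathrm{Ind}_{T_p}^T\sigma$ of $T$ is not equivalent to the unitary representation $\rho_s$ of $T$ on $L^2(S^1,\nu)$ given by $\rho_s(\gamma) f = \left(\frac{d\gamma_*\nu}{d\nu}\right)^{1/2+is} \, f\circ\gamma^{-1}$, where $\nu$ is the pushforward of the Lebesgue measure on $[0,1]$ under $\eta(t)=e^{2\pi i t}$.
   Context: Thompson's group $F$ consists of all orientation-preserving piecewise linear homeomorphisms $\phi$ of the unit interval $[0,1]$ such that (1) $\phi$ preserves the set $\mathbb{Z}[1/2]\cap[0,1]$ of dyadic rationals in $[0,1]$; (2) $\phi$ has finitely many nondifferentiability points, all lying in $\mathbb{Z}[1/2]$; (3) the slopes of $\phi$ are of the form $2^k$, $k\in\mathbb{Z}$. The surjection $\eta\colon[0,1]\to S^1=\{z\in\mathbb{C}:|z|=1\}$, $\eta(t)=e^{2\pi i t}$, induces a faithful action of $F$ on $S^1$ (by $\gamma\cdot\eta(t)=\eta(\gamma(t))$). Let $R$ be the group of rotations of $S^1$ with angles in $\pi\mathbb{Z}[1/2]$. Thompson's group $T$ is the group of homeomorphisms of $S^1$ generated by $F$ (viewed as acting on $S^1$) and $R$; it is regarded as a discrete group. $T_p=\{\gamma\in T:\gamma(p)=p\}$. The measure $\nu$ is quasi-invariant under $T$; $\gamma_*\nu$ is its pushforward and $d\gamma_*\nu/d\nu$ the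 Radon–Nikodym derivative. For a subgroup $H$ of a discrete group $G$ and a unitary representation $\sigma$ of $H$, $\mathrm{Ind}_H^G\sigma$ denotes the usual unitarily induced ($\ell^2$) representation of $G$. Equivalence means unitary equivalence. *)

theory Defs
  imports
    "HOL-Analysis.Analysis"
    "HOL-Algebra.Module"
    "HOL-Algebra.Bij"
    "HOL-Algebra.Generated_Groups"
    "HOL-Algebra.Group_Action"
    "HOL-Algebra.Left_Coset"
begin

section \<open>Complex Hilbert spaces with explicit carriers\<close>

definition complex_ring :: "complex ring" where
  "complex_ring = \<lparr>carrier = UNIV, mult = (*), one = 1, zero = 0, add = (+)\<rparr>"

text \<open>The ring fields \<open>mult\<close> and \<open>one\<close> that the library's module record inherits play no role;
  they are \<open>undefined\<close> in the spaces constructed below.\<close>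

record 'v inner_module = "(complex, 'v) module" +
  ip :: "'v \<Rightarrow> 'v \<Rightarrow> complex"

definition ip_norm :: "('v, 'm) inner_module_scheme \<Rightarrow> 'v \<Rightarrow> real" where
  "ip_norm V x = sqrt (Re (ip V x x))"

text \<open>Inner products are linear in the first argument.\<close>

locale complex_inner_product_space = module complex_ring V
  for V :: "('v, 'm) inner_module_scheme" (structure) +
  assumes ip_add: "\<lbrakk>x \<in> carrier V; y \<in> carrier V; z \<in> carrier V\<rbrakk>
      \<Longrightarrow> ip V (x \<oplus> y) z = ip V x z + ip V y z"
    and ip_smult: "\<lbrakk>x \<in> carrier V; z \<in> carrier V\<rbrakk> \<Longrightarrow> ip V (c \<odot> x) z = c * ip V x z"
    and ip_cnj: "\<lbrakk>x \<in> carrier V; y \<in> carrier V\<rbrakk> \<Longrightarrow> ip V y x = cnj (ip V x y)"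
    and ip_pos: "\<lbrakk>x \<in> carrier V; x \<noteq> \<zero>\<rbrakk> \<Longrightarrow> 0 < Re (ip V x x)"

locale complex_hilbert_space = complex_inner_product_space V
  for V :: "('v, 'm) inner_module_scheme" (structure) +
  assumes complete:
    "\<lbrakk>\<And>n. X n \<in> carrier V;
      \<And>e. 0 < e \<Longrightarrow> \<exists>N. \<forall>m\<ge>N. \<forall>n\<ge>N. ip_norm V (X m \<ominus> X n) < e\<rbrakk>
     \<Longrightarrow> \<exists>l\<in>carrier V. (\<lambda>n. ip_norm V (X n \<ominus> l)) \<longlonglongrightarrow> 0"

definition finite_dimensional :: "('v, 'm) inner_module_scheme \<Rightarrow> bool" where
  "finite_dimensional V \<longleftrightarrow> (\<exists>B. finite B \<and> B \<subseteq> carrier V \<and>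
     (\<forall>v\<in>carrier V. \<exists>a. v = (\<Oplus>\<^bsub>V\<^esub>b\<in>B. a b \<odot>\<^bsub>V\<^esub> b)))"


section \<open>Unitary representations\<close>

definition unitary_maps ::
  "('v, 'm) inner_module_scheme \<Rightarrow> ('w, 'n) inner_module_scheme \<Rightarrow> ('v \<Rightarrow> 'w) set" where
  "unitary_maps V W = {U \<in> extensional (carrier V). bij_betw U (carrier V) (carrier W) \<and>
     (\<forall>x\<in>carrier V. \<forall>y\<in>carrier V. U (x \<oplus>\<^bsub>V\<^esub> y) = U x \<oplus>\<^bsub>W\<^esub> U y) \<and>
     (\<forall>c. \<forall>x\<in>carrier V. U (c \<odot>\<^bsub>V\<^esub> x) = c \<odot>\<^bsub>W\<^esub> U x) \<and>
     (\<forall>x\<in>carrier V. \<forall>y\<in>carrier V. ip W (U x) (U y) = ip V x y)}"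

definition unitary_group :: "('v, 'm) inner_module_scheme \<Rightarrow> ('v \<Rightarrow> 'v) monoid" where
  "unitary_group V = (BijGroup (carrier V))\<lparr>carrier := unitary_maps V V\<rparr>"

definition unitary_rep ::
  "('g, 'k) monoid_scheme \<Rightarrow> ('v, 'm) inner_module_scheme \<Rightarrow> ('g \<Rightarrow> 'v \<Rightarrow> 'v) \<Rightarrow> bool" where
  "unitary_rep G V \<pi> \<longleftrightarrow> complex_hilbert_space V \<and> \<pi> \<in> hom G (unitary_group V)"

definition unitarily_equivalent ::
  "('g, 'k) monoid_scheme \<Rightarrow> ('v, 'm) inner_module_scheme \<Rightarrow> ('g \<Rightarrow> 'v \<Rightarrow> 'v) \<Rightarrow>
   ('w, 'n) inner_module_scheme \<Rightarrow> ('g \<Rightarrow> 'w \<Rightarrow> 'w) \<Rightarrow> bool" where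
  "unitarily_equivalent G V \<pi> W \<tau> \<longleftrightarrow>
     (\<exists>U\<in>unitary_maps V W. \<forall>g\<in>carrier G. \<forall>v\<in>carrier V. U (\<pi> g v) = \<tau> g (U v))"


section \<open>Unitary induction\<close>

text \<open>The induced space consists of the functions \<open>f\<close> on \<open>G\<close> with
  \<open>f (g h) = \<sigma> (h\<^sup>-\<^sup>1) (f g)\<close> for \<open>h\<close> in \<open>H\<close> whose norms, which are constant on left cosets of \<open>H\<close>,
  are square-summable over \<open>G/H\<close>. As \<open>\<sigma>\<close> is unitary, the choice of coset representatives
  does not matter.\<close>

definition coset_rep :: "'g set \<Rightarrow> 'g" where
  "coset_rep C = (SOME g. g \<in> C)"

definition induced_space ::
  "('g, 'k) monoid_scheme \<Rightarrow> 'g set \<Rightarrow> ('v, 'm) inner_module_scheme \<Rightarrow> ('g \<Rightarrow> 'v \<Rightarrow> 'v) \<Rightarrow>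
   ('g \<Rightarrow> 'v) inner_module" where
  "induced_space G H V \<sigma> =
    \<lparr>carrier = {f \<in> carrier G \<rightarrow>\<^sub>E carrier V.
       (\<forall>g\<in>carrier G. \<forall>h\<in>H. f (g \<otimes>\<^bsub>G\<^esub> h) = \<sigma> (inv\<^bsub>G\<^esub> h) (f g)) \<and>
       (\<lambda>C. (ip_norm V (f (coset_rep C)))\<^sup>2) summable_on (lcosets\<^bsub>G\<^esub> H)},
     mult = undefined, one = undefined,
     zero = (\<lambda>x\<in>carrier G. \<zero>\<^bsub>V\<^esub>),
     add = (\<lambda>f f'. \<lambda>x\<in>carrier G. f x \<oplus>\<^bsub>V\<^esub> f' x),
     smult = (\<lambda>c f. \<lambda>x\<in>carrier G. c \<odot>\<^bsub>V\<^esub> f x),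
     ip = (\<lambda>f f'. \<Sum>\<^sub>\<infinity>C\<in>lcosets\<^bsub>G\<^esub> H. ip V (f (coset_rep C)) (f' (coset_rep C)))\<rparr>"

definition induced_rep ::
  "('g, 'k) monoid_scheme \<Rightarrow> 'g set \<Rightarrow> ('v, 'm) inner_module_scheme \<Rightarrow> ('g \<Rightarrow> 'v \<Rightarrow> 'v) \<Rightarrow>
   'g \<Rightarrow> ('g \<Rightarrow> 'v) \<Rightarrow> ('g \<Rightarrow> 'v)" where
  "induced_rep G H V \<sigma> g =
     (\<lambda>f\<in>carrier (induced_space G H V \<sigma>). \<lambda>x\<in>carrier G. f (inv\<^bsub>G\<^esub> g \<otimes>\<^bsub>G\<^esub> x))"


section \<open>Complex \<open>L\<^sup>2\<close> spaces\<close>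

definition square_integrable :: "'a measure \<Rightarrow> ('a \<Rightarrow> complex) set" where
  "square_integrable M =
     {f \<in> borel_measurable M. integrable M (\<lambda>x. (cmod (f x))\<^sup>2)}"

definition ae_eq :: "'a measure \<Rightarrow> (('a \<Rightarrow> complex) \<times> ('a \<Rightarrow> complex)) set" where
  "ae_eq M = {(f, g). f \<in> square_integrable M \<and> g \<in> square_integrable M \<and>
     (AE x in M. f x = g x)}"

definition L2_space :: "'a measure \<Rightarrow> ('a \<Rightarrow> complex) set inner_module" where
  "L2_space M =
    \<lparr>carrier = square_integrable M // ae_eq M,
     mult = undefined, one = undefined,
     zero = ae_eq M `` {\<lambda>x. 0},
     add = (\<lambda>A B. \<Union>f\<in>A. \<Union>g\<in>B. ae_eq M `` {\<lambda>x. f x + g x}),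
     smult = (\<lambda>c A. \<Union>f\<in>A. ae_eq M `` {\<lambda>x. c * f x}),
     ip = (\<lambda>A B. the_elem (\<Union>f\<in>A. \<Union>g\<in>B. {LINT x|M. f x * cnj (g x)}))\<rparr>"


section \<open>Thompson's groups \<open>F\<close> and \<open>T\<close>\<close>

definition dyadic_rationals :: "real set" where
  "dyadic_rationals = {x. \<exists>(m::int) (n::nat). x = of_int m / 2 ^ n}"

definition piecewise_linear_on :: "real set \<Rightarrow> (real \<Rightarrow> real) \<Rightarrow> bool" where
  "piecewise_linear_on I \<phi> \<longleftrightarrow> (\<exists>S. finite S \<and>
     (\<forall>u v. {u..v} \<subseteq> I \<and> {u<..<v} \<inter> S = {} \<longrightarrow>
        (\<exists>a b. \<forall>x\<in>{u..v}. \<phi> x = a * x + b)))"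

text \<open>Derivatives are taken within \<open>{0..1}\<close>, that is, one-sided at the endpoints.\<close>

definition thompson_F :: "(real \<Rightarrow> real) set" where
  "thompson_F = {\<phi> \<in> extensional {0..1}.
     (\<exists>\<psi>. homeomorphism {0..1} {0..1} \<phi> \<psi>) \<and>
     strict_mono_on {0..1} \<phi> \<and>
     piecewise_linear_on {0..1} \<phi> \<and>
     \<phi> ` (dyadic_rationals \<inter> {0..1}) = dyadic_rationals \<inter> {0..1} \<and>
     finite {x\<in>{0..1}. \<not> \<phi> differentiable (at x within {0..1})} \<and>
     {x\<in>{0..1}. \<not> \<phi> differentiable (at x within {0..1})} \<subseteq> dyadic_rationals \<and>
     (\<forall>x\<in>{0..1}. \<forall>d. (\<phi> has_real_derivative d) (at x within {0..1}) \<longrightarrow>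
        (\<exists>k::int. d = 2 powi k))}"

abbreviation circle :: "complex set" where
  "circle \<equiv> sphere 0 1"

definition eta :: "real \<Rightarrow> complex" where
  "eta t = exp (2 * of_real pi * \<i> * of_real t)"

definition circle_F :: "(complex \<Rightarrow> complex) set" where
  "circle_F = {g \<in> Bij circle. \<exists>\<phi>\<in>thompson_F. \<forall>t\<in>{0..1}. g (eta t) = eta (\<phi> t)}"

definition circle_R :: "(complex \<Rightarrow> complex) set" where
  "circle_R = {\<lambda>z\<in>circle. cis (pi * a) * z | a. a \<in> dyadic_rationals}"

definition thompson_T :: "(complex \<Rightarrow> complex) monoid" where
  "thompson_T = (BijGroup circle)
     \<lparr>carrier := generate (BijGroup circle) (circle_F \<union> circle_R)\<rparr>"

definition T_stab :: "complex \<Rightarrow> (complex \<Rightarrow> complex) set" where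
  "T_stab p = stabilizer thompson_T (\<lambda>\<gamma>. \<gamma>) p"


section \<open>The representations \<open>\<rho>\<^sub>s\<close>\<close>

definition nu :: "complex measure" where
  "nu = distr (restrict_space lborel {0..1}) (restrict_space borel circle) eta"

definition rho ::
  "real \<Rightarrow> (complex \<Rightarrow> complex) \<Rightarrow> (complex \<Rightarrow> complex) set \<Rightarrow> (complex \<Rightarrow> complex) set" where
  "rho s \<gamma> = (\<lambda>A\<in>carrier (L2_space nu). \<Union>f\<in>A. ae_eq nu ``
     {\<lambda>z. of_real (enn2real (RN_deriv nu (distr nu nu \<gamma>) z)) powr Complex (1/2) s
            * f ((inv\<^bsub>thompson_T\<^esub> \<gamma>) z)})"

end

theory Submission
  imports Defs
begin

text \<open>A vector \<open>v\<close> of \<open>V\<close>, placed at the base coset of \<open>T/T\<^sub>p\<close>, lies in a finite-dimensional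
  \<open>T\<^sub>p\<close>-invariant subspace of the induced representation. If the induced representation were
  equivalent to \<open>\<rho>\<^sub>s\<close>, there would be a nonzero \<open>f\<close> in \<open>L\<^sup>2\<close> such that
  \<open>\<bar>\<rho>\<^sub>s(\<gamma>) f\<bar>\<^sup>2\<close> is dominated by one integrable function \<open>G\<close>, uniformly in \<open>\<gamma> \<in> T\<^sub>p\<close>.
  Now \<open>\<bar>\<rho>\<^sub>s(\<gamma>) f\<bar>\<^sup>2 \<nu>\<close> is the pushforward of \<open>\<bar>f\<bar>\<^sup>2 \<nu>\<close> under \<open>\<gamma>\<close>, and \<open>T\<^sub>p\<close> contains elements
  that map the complement of an arbitrarily small set \<open>C\<close> into \<open>C\<close>. For these
  \<open>\<integral> \<bar>f\<bar>\<^sup>2 \<le> \<integral>\<^bsub>C\<^esub> \<bar>f\<bar>\<^sup>2 + \<integral>\<^bsub>C\<^esub> G\<close>, and the right-hand side tends to \<open>0\<close>.\<close>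

text \<open>Uniformity in \<gamma> comes from finite dimension: the coordinates of
  \<open>\<sigma> \<gamma> v\<close> in a fixed orthonormal basis of \<open>V\<close> are bounded by
  the norm of \<open>v\<close>, so representatives chosen once for the images of the basis vectors
  dominate all translates. The parameter \<open>s\<close> enters only through a factor of modulus
  one, which the squared absolute value removes. The obstacle is that \<open>p\<close> is arbitrary.
  At an irrational angle an element of the stabilizer is the identity near \<open>p\<close>, because
  its affine pieces have dyadic coefficients, so \<open>p\<close> cannot serve as an attracting
  point. The elements used here instead fix a short arc containing \<open>p\<close> pointwise and
  compress nearly all of the remaining circle into a short arc adjacent to it. Both arcs shrink at a
  geometric rate, and this gives the limit almost everywhere by Borel-Cantelli.\<close>

section \<open>Finite orthonormal bases\<close>

context complex_inner_product_space
begin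

lemma smult_complex_closed [simp, intro]: "x \<in> carrier V \<Longrightarrow> c \<odot> x \<in> carrier V"
  by (rule smult_closed) (simp_all add: complex_ring_def)

lemma smult_one_complex [simp]: "x \<in> carrier V \<Longrightarrow> 1 \<odot> x = x"
  using smult_one by (simp add: complex_ring_def)

lemma smult_zero_complex [simp]: "x \<in> carrier V \<Longrightarrow> 0 \<odot> x = \<zero>"
  using smult_l_null by (simp add: complex_ring_def)

lemma smult_smult: "x \<in> carrier V \<Longrightarrow> a \<odot> (b \<odot> x) = (a * b) \<odot> x"
  using smult_assoc1[of a b x] by (simp add: complex_ring_def)

lemma smult_add_left: "x \<in> carrier V \<Longrightarrow> (a + b) \<odot> x = a \<odot> x \<oplus> b \<odot> x"
  using smult_l_distr[of a b x] by (simp add: complex_ring_def)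

lemma smult_finsum:
  "\<lbrakk>finite E; f \<in> E \<rightarrow> carrier V\<rbrakk> \<Longrightarrow> c \<odot> (\<Oplus>e\<in>E. f e) = (\<Oplus>e\<in>E. c \<odot> f e)"
  using finsum_smult_ldistr[of E c f] by (simp add: complex_ring_def)

lemma ip_zero_left [simp]: "z \<in> carrier V \<Longrightarrow> ip V \<zero> z = 0"
  using ip_smult[of \<zero> z 0] by simp

lemma ip_add_right:
  assumes "x \<in> carrier V" "y \<in> carrier V" "z \<in> carrier V"
  shows "ip V z (x \<oplus> y) = ip V z x + ip V z y"
  using ip_cnj[of "x \<oplus> y" z] ip_cnj[of x z] ip_cnj[of y z] assms by (simp add: ip_add)

lemma ip_smult_right:
  assumes "x \<in> carrier V" "z \<in> carrier V"
  shows "ip V z (c \<odot> x) = cnj c * ip V z x"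
  using ip_cnj[of "c \<odot> x" z] ip_cnj[of x z] assms by (simp add: ip_smult)

lemma ip_self: "x \<in> carrier V \<Longrightarrow> ip V x x = of_real ((ip_norm V x)\<^sup>2)"
proof -
  assume x: "x \<in> carrier V"
  have "Im (ip V x x) = 0"
    using ip_cnj[OF x x] by (metis cnj.simps(2) equal_neg_zero)
  moreover have "0 \<le> Re (ip V x x)"
    using ip_pos[OF x] x by (cases "x = \<zero>") auto
  ultimately show ?thesis
    by (simp add: ip_norm_def complex_eq_iff)
qed

lemma ip_norm_pos: "\<lbrakk>x \<in> carrier V; x \<noteq> \<zero>\<rbrakk> \<Longrightarrow> 0 < ip_norm V x"
  by (simp add: ip_norm_def ip_pos)

lemma ip_finsum:
  assumes "finite E" "f \<in> E \<rightarrow> carrier V" "z \<in> carrier V"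
  shows "ip V (\<Oplus>e\<in>E. f e) z = (\<Sum>e\<in>E. ip V (f e) z)"
  using assms by (induction E rule: finite_induct) (auto simp: ip_add Pi_iff)

text \<open>The squared norm of v - <v,e> e equals \<parallel>v\<parallel>^2 - \<bar><v,e>\<bar>^2
  and is nonnegative. This bound makes the dominating function independent of the group
  element.\<close>

lemma cmod_ip_le:
  assumes "v \<in> carrier V" "e \<in> carrier V" "ip V e e = 1"
  shows "cmod (ip V v e) \<le> ip_norm V v"
proof -
  define c where "c = ip V v e"
  define w where "w = v \<oplus> (- c) \<odot> e"
  have w: "w \<in> carrier V" using assms by (simp add: w_def)
  have "ip V e v = cnj c" using ip_cnj[of v e] assms by (simp add: c_def)
  then have "ip V w w = ip V v v - c * cnj c"
    using assms by (simp add: w_def ip_add ip_add_right ip_smult ip_smult_right c_def[symmetric])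
  then have "of_real ((ip_norm V w)\<^sup>2) = complex_of_real ((ip_norm V v)\<^sup>2 - (cmod c)\<^sup>2)"
    using assms(1) w by (simp add: ip_self complex_norm_square[symmetric])
  then have "(ip_norm V w)\<^sup>2 = (ip_norm V v)\<^sup>2 - (cmod c)\<^sup>2"
    by (simp only: of_real_eq_iff)
  then have "(cmod c)\<^sup>2 \<le> (ip_norm V v)\<^sup>2" by (metis diff_ge_0_iff_ge zero_le_power2)
  moreover have "0 \<le> ip_norm V v"
    using ip_norm_pos[OF assms(1)] assms(1) by (cases "v = \<zero>") (auto simp: ip_norm_def)
  ultimately show ?thesis unfolding c_def by (rule power2_le_imp_le)
qed

definition orthonormal :: "'v set \<Rightarrow> bool" where
  "orthonormal E \<longleftrightarrow> E \<subseteq> carrier V \<and> (\<forall>e\<in>E. \<forall>e'\<in>E. ip V e e' = (if e = e' then 1 else 0))"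

text \<open>For finite orthonormal \<open>E\<close> this is the orthogonal projection onto the span
  of \<open>E\<close>, so the equation \<open>expansion E v = v\<close> encodes that
  \<open>v\<close> lies in that span.\<close>

definition expansion :: "'v set \<Rightarrow> 'v \<Rightarrow> 'v" where
  "expansion E v = (\<Oplus>e\<in>E. ip V v e \<odot> e)"

lemma expansion_closed [simp, intro]: "E \<subseteq> carrier V \<Longrightarrow> expansion E v \<in> carrier V"
  unfolding expansion_def by (rule M.finsum_closed) auto

lemma expansion_add:
  assumes "finite E" "E \<subseteq> carrier V" "v \<in> carrier V" "w \<in> carrier V"
  shows "expansion E (v \<oplus> w) = expansion E v \<oplus> expansion E w"
proof -
  have "expansion E (v \<oplus> w) = (\<Oplus>e\<in>E. ip V v e \<odot> e \<oplus> ip V w e \<odot> e)"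
    unfolding expansion_def
    by (rule M.finsum_cong') (use assms in \<open>auto simp: ip_add smult_add_left subset_iff\<close>)
  also have "\<dots> = expansion E v \<oplus> expansion E w"
    unfolding expansion_def by (rule M.finsum_addf) (use assms in auto)
  finally show ?thesis .
qed

lemma expansion_smult:
  assumes "finite E" "E \<subseteq> carrier V" "v \<in> carrier V"
  shows "expansion E (c \<odot> v) = c \<odot> expansion E v"
proof -
  have "expansion E (c \<odot> v) = (\<Oplus>e\<in>E. c \<odot> (ip V v e \<odot> e))"
    unfolding expansion_def
    by (rule M.finsum_cong') (use assms in \<open>auto simp: ip_smult smult_smult subset_iff\<close>)
  also have "\<dots> = c \<odot> expansion E v"
    unfolding expansion_def by (rule smult_finsum[symmetric]) (use assms in auto)
  finally show ?thesis .
qed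

lemma expansion_finsum:
  assumes "finite E" "E \<subseteq> carrier V" "finite B" "B \<subseteq> carrier V"
    and "\<And>b. b \<in> B \<Longrightarrow> expansion E b = b"
  shows "expansion E (\<Oplus>b\<in>B. a b \<odot> b) = (\<Oplus>b\<in>B. a b \<odot> b)"
  using assms(3-5)
proof (induction B rule: finite_induct)
  case empty
  have "expansion E \<zero> = 0 \<odot> expansion E \<zero>"
    using expansion_smult[of E \<zero> 0] assms(1,2) by simp
  then show ?case using assms(2) by simp
next
  case (insert b B)
  then have "(\<Oplus>b\<in>insert b B. a b \<odot> b) = a b \<odot> b \<oplus> (\<Oplus>b\<in>B. a b \<odot> b)"
    by (intro M.finsum_insert) auto
  moreover have "(\<Oplus>b\<in>B. a b \<odot> b) \<in> carrier V"
    using insert by (intro M.finsum_closed) auto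
  ultimately show ?case
    using insert assms(1,2) by (simp add: expansion_add expansion_smult)
qed

lemma ip_expansion:
  assumes "finite E" "orthonormal E" "v \<in> carrier V" "e \<in> E"
  shows "ip V (expansion E v) e = ip V v e"
proof -
  have "ip V (expansion E v) e = (\<Sum>d\<in>E. ip V (ip V v d \<odot> d) e)"
    unfolding expansion_def by (rule ip_finsum) (use assms in \<open>auto simp: orthonormal_def\<close>)
  also have "\<dots> = (\<Sum>d\<in>E. if d = e then ip V v e else 0)"
    by (rule sum.cong) (use assms in \<open>auto simp: orthonormal_def ip_smult subset_iff\<close>)
  finally show ?thesis using assms by simp
qed

lemma ip_expansion_orthogonal:
  assumes "finite E" "E \<subseteq> carrier V" "u \<in> carrier V" "\<And>e. e \<in> E \<Longrightarrow> ip V e u = 0"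
  shows "ip V (expansion E v) u = 0"
proof -
  have "ip V (expansion E v) u = (\<Sum>d\<in>E. ip V (ip V v d \<odot> d) u)"
    unfolding expansion_def by (rule ip_finsum) (use assms in auto)
  also have "\<dots> = 0"
    by (rule sum.neutral) (use assms in \<open>auto simp: ip_smult subset_iff\<close>)
  finally show ?thesis .
qed

text \<open>The conclusion records just that each \<open>b\<close> lies in the span of
  \<open>E\<close>. Linearly dependent vectors are therefore harmless: when the remainder
  \<open>r\<close> vanishes, \<open>E\<close> is kept as it is.\<close>

lemma gram_schmidt:
  assumes "finite B" "B \<subseteq> carrier V"
  shows "\<exists>E. finite E \<and> orthonormal E \<and> (\<forall>b\<in>B. expansion E b = b)"
  using assms
proof (induction B rule: finite_induct)
  case empty
  then show ?case by (intro exI[of _ "{}"]) (simp add: orthonormal_def)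
next
  case (insert b B)
  then obtain E where E: "finite E" "orthonormal E" "\<And>x. x \<in> B \<Longrightarrow> expansion E x = x"
    by auto
  have EV: "E \<subseteq> carrier V" using E(2) by (simp add: orthonormal_def)
  have b: "b \<in> carrier V" and BV: "B \<subseteq> carrier V" using insert by auto
  define q where "q = expansion E b"
  define r where "r = b \<oplus> (- 1) \<odot> q"
  have q: "q \<in> carrier V" and r: "r \<in> carrier V" using b EV by (simp_all add: q_def r_def)
  have "r \<oplus> q = b \<oplus> ((- 1) \<odot> q \<oplus> 1 \<odot> q)" using b q by (simp add: r_def M.a_assoc)
  also have "\<dots> = b" using b q by (simp add: smult_add_left[symmetric] del: smult_one_complex)
  finally have rq: "r \<oplus> q = b" .
  have re: "ip V r e = 0" if "e \<in> E" for e
  proof -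
    have "e \<in> carrier V" using that EV by auto
    then show ?thesis
      using ip_expansion[OF E(1,2) b that] b q by (simp add: r_def ip_add ip_smult q_def)
  qed
  show ?case
  proof (cases "r = \<zero>")
    case True
    then have "expansion E b = b" using rq q by (simp add: q_def)
    then show ?thesis using E by auto
  next
    case False
    define n where "n = complex_of_real (ip_norm V r)"
    have n: "n \<noteq> 0" "cnj n = n" "ip V r r = n * n"
      using ip_norm_pos[OF r False] by (simp_all add: n_def ip_self[OF r] power2_eq_square)
    define u where "u = (1 / n) \<odot> r"
    have u: "u \<in> carrier V" using r by (simp add: u_def)
    have uu: "ip V u u = 1" using r n by (simp add: u_def ip_smult ip_smult_right)
    have ue: "ip V u e = 0" if "e \<in> E" for e
      using re[OF that] r EV that by (auto simp: u_def ip_smult subset_iff)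
    have eu: "ip V e u = 0" if "e \<in> E" for e
      using ue[OF that] ip_cnj[OF u, of e] EV that by auto
    have uE: "u \<notin> E" using ue uu by auto
    have on: "orthonormal (insert u E)"
      using E(2) u uu ue eu by (auto simp: orthonormal_def)
    have ins: "expansion (insert u E) v = ip V v u \<odot> u \<oplus> expansion E v" if "v \<in> carrier V" for v
      unfolding expansion_def by (rule M.finsum_insert) (use E(1) uE EV u in auto)
    \<comment> \<open>A vector fixed by \<open>expansion E\<close> is orthogonal to the new
      \<open>u\<close>, so the additional term is zero.\<close>
    have "expansion (insert u E) x = x" if "x \<in> B" for x
    proof -
      have x: "x \<in> carrier V" using BV that by auto
      have "ip V x u = 0"
        using ip_expansion_orthogonal[OF E(1) EV u eu, of x] E(3)[OF that] by simp
      then show ?thesis using ins[OF x] E(3)[OF that] x u by simp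
    qed
    \<comment> \<open>Since \<open>q\<close> is orthogonal to \<open>u\<close>, the coefficient of
      \<open>b\<close> along \<open>u\<close> is that of \<open>r\<close>, namely \<open>n\<close>,
      which undoes the normalization.\<close>
    moreover have "expansion (insert u E) b = b"
    proof -
      have "ip V q u = 0"
        using ip_expansion_orthogonal[OF E(1) EV u eu, of b] by (simp add: q_def)
      then have "ip V b u = ip V r u" using ip_add[OF r q u] rq by simp
      also have "\<dots> = n" using r n by (simp add: u_def ip_smult_right)
      finally have "ip V b u \<odot> u = r" using r n by (simp add: u_def smult_smult)
      then show ?thesis using ins[OF b] rq by (simp add: q_def)
    qed
    ultimately show ?thesis using on E(1) by (intro exI[of _ "insert u E"]) auto
  qed
qed

lemma finite_orthonormal_basis:
  assumes "finite_dimensional V"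
  obtains E where "finite E" "orthonormal E" "\<And>v. v \<in> carrier V \<Longrightarrow> expansion E v = v"
proof -
  obtain B where B: "finite B" "B \<subseteq> carrier V"
    and span: "\<forall>v\<in>carrier V. \<exists>a. v = (\<Oplus>b\<in>B. a b \<odot> b)"
    using assms unfolding finite_dimensional_def by auto
  obtain E where E: "finite E" "orthonormal E" "\<And>b. b \<in> B \<Longrightarrow> expansion E b = b"
    using gram_schmidt[OF B] by auto
  have "expansion E v = v" if v: "v \<in> carrier V" for v
  proof -
    obtain a where "v = (\<Oplus>b\<in>B. a b \<odot> b)" using span v by auto
    then show ?thesis
      using expansion_finsum[of E B a] E B by (simp add: orthonormal_def)
  qed
  then show thesis using that E(1,2) by blast
qed

end

section \<open>Vectors supported on the base coset\<close>

text \<open>Once the value at the identity is \<open>v\<close>, the covariance condition of the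
  induced space forces this value at each \<open>x\<close> in \<open>H\<close>.\<close>

definition coset_delta ::
  "('g, 'k) monoid_scheme \<Rightarrow> 'g set \<Rightarrow> ('v, 'm) inner_module_scheme \<Rightarrow> ('g \<Rightarrow> 'v \<Rightarrow> 'v) \<Rightarrow>
   'v \<Rightarrow> 'g \<Rightarrow> 'v" where
  "coset_delta G H V \<sigma> v =
     (\<lambda>x\<in>carrier G. if x \<in> H then \<sigma> (inv\<^bsub>G\<^esub> x) v else \<zero>\<^bsub>V\<^esub>)"

lemma unitary_mapsD:
  assumes "U \<in> unitary_maps V W"
  shows "x \<in> carrier V \<Longrightarrow> U x \<in> carrier W"
    and "\<lbrakk>x \<in> carrier V; y \<in> carrier V\<rbrakk> \<Longrightarrow> U (x \<oplus>\<^bsub>V\<^esub> y) = U x \<oplus>\<^bsub>W\<^esub> U y"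
    and "x \<in> carrier V \<Longrightarrow> U (c \<odot>\<^bsub>V\<^esub> x) = c \<odot>\<^bsub>W\<^esub> U x"
    and "\<lbrakk>x \<in> carrier V; y \<in> carrier V\<rbrakk> \<Longrightarrow> ip W (U x) (U y) = ip V x y"
  using assms by (auto simp: unitary_maps_def bij_betw_def)

lemma unitary_maps_surj:
  assumes "U \<in> unitary_maps V W" "y \<in> carrier W"
  shows "\<exists>x\<in>carrier V. U x = y"
proof -
  have "U ` carrier V = carrier W" using assms(1) by (simp add: unitary_maps_def bij_betw_def)
  then have "y \<in> U ` carrier V" using assms(2) by simp
  then show ?thesis by (auto elim!: imageE)
qed

locale induced_representation = G: group G + complex_hilbert_space V
  for G (structure) and V :: "('v, 'm) inner_module_scheme" and H \<sigma> +
  assumes subgroup: "subgroup H G"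
    and hom: "\<sigma> \<in> hom (G\<lparr>carrier := H\<rparr>) (unitary_group V)"
begin

abbreviation \<delta> where "\<delta> \<equiv> coset_delta G H V \<sigma>"

abbreviation Ind where "Ind \<equiv> induced_space G H V \<sigma>"

lemma unitary: "h \<in> H \<Longrightarrow> \<sigma> h \<in> unitary_maps V V"
  using hom by (auto simp: hom_def unitary_group_def)

lemma sigma_closed [simp, intro]: "\<lbrakk>h \<in> H; v \<in> carrier V\<rbrakk> \<Longrightarrow> \<sigma> h v \<in> carrier V"
  using unitary_mapsD(1)[OF unitary] .

lemma sigma_mult:
  assumes "h \<in> H" "k \<in> H" "v \<in> carrier V"
  shows "\<sigma> (h \<otimes> k) v = \<sigma> h (\<sigma> k v)"
proof -
  have "\<sigma> (h \<otimes> k) = \<sigma> h \<otimes>\<^bsub>BijGroup (carrier V)\<^esub> \<sigma> k"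
    using hom_mult[OF hom] assms by (simp add: unitary_group_def)
  moreover have "\<sigma> h \<in> Bij (carrier V)" "\<sigma> k \<in> Bij (carrier V)"
    using unitary assms by (auto simp: unitary_maps_def Bij_def)
  ultimately show ?thesis using assms(3) by (simp add: BijGroup_def compose_def)
qed

lemma sigma_zero: "h \<in> H \<Longrightarrow> \<sigma> h \<zero>\<^bsub>V\<^esub> = \<zero>\<^bsub>V\<^esub>"
proof -
  assume h: "h \<in> H"
  have "\<sigma> h \<zero>\<^bsub>V\<^esub> \<oplus>\<^bsub>V\<^esub> \<sigma> h \<zero>\<^bsub>V\<^esub> = \<sigma> h \<zero>\<^bsub>V\<^esub>"
    using unitary_mapsD(2)[OF unitary[OF h], of "\<zero>\<^bsub>V\<^esub>" "\<zero>\<^bsub>V\<^esub>"] by simp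
  then show ?thesis using h by (metis M.add.r_cancel_one' M.zero_closed sigma_closed)
qed

lemma H_carrier: "h \<in> H \<Longrightarrow> h \<in> carrier G"
  using subgroup.mem_carrier[OF subgroup] .

lemma delta_closed: "v \<in> carrier V \<Longrightarrow> \<delta> v \<in> carrier G \<rightarrow>\<^sub>E carrier V"
  by (auto simp: coset_delta_def subgroup.m_inv_closed[OF subgroup])

lemma H_lcoset: "H \<in> lcosets H"
proof -
  have "\<one> <# H = H"
    using subgroup.subset[OF subgroup] by (rule G.lcos_mult_one)
  then show ?thesis by (force simp: LCOSETS_def)
qed

lemma coset_rep_in_coset:
  assumes "C \<in> lcosets H"
  shows "coset_rep C \<in> C"
proof -
  obtain a where "a \<in> carrier G" "C = a <# H" using assms by (auto simp: LCOSETS_def)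
  then have "a \<in> C" using G.lcos_self[OF _ subgroup] by simp
  then show ?thesis unfolding coset_rep_def by (rule someI)
qed

lemma coset_rep_carrier: "C \<in> lcosets H \<Longrightarrow> coset_rep C \<in> carrier G"
  using coset_rep_in_coset subgroup.lcosets_carrier[OF subgroup G.group_axioms] by blast

lemma coset_rep_in_H:
  assumes "C \<in> lcosets H"
  shows "coset_rep C \<in> H \<longleftrightarrow> C = H"
  using coset_rep_in_coset[OF assms] G.lcos_disjoint[OF subgroup assms H_lcoset] by blast

lemma delta_coset_rep:
  assumes "C \<in> lcosets H" "C \<noteq> H"
  shows "\<delta> v (coset_rep C) = \<zero>\<^bsub>V\<^esub>"
  using assms by (simp add: coset_delta_def coset_rep_carrier coset_rep_in_H)

text \<open>Covariance on \<open>H\<close> is multiplicativity of \<sigma>; off \<open>H\<close>,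
  right translation by \<open>h\<close> stays off \<open>H\<close> and both sides vanish. A single
  coset carries the norm, so summability is that of a one-point sum.\<close>

lemma delta_in_carrier:
  assumes v: "v \<in> carrier V"
  shows "\<delta> v \<in> carrier Ind"
proof -
  have "\<delta> v (g \<otimes> h) = \<sigma> (inv h) (\<delta> v g)" if "g \<in> carrier G" "h \<in> H" for g h
  proof (cases "g \<in> H")
    case True
    then have "g \<otimes> h \<in> H" using that subgroup.m_closed[OF subgroup] by blast
    moreover have "\<sigma> (inv (g \<otimes> h)) v = \<sigma> (inv h) (\<sigma> (inv g) v)"
      using True that v subgroup.m_inv_closed[OF subgroup]
      by (simp add: G.inv_mult_group H_carrier sigma_mult)
    ultimately show ?thesis using True that by (simp add: coset_delta_def H_carrier)
  next
    case False
    then have "g \<otimes> h \<notin> H"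
      using that subgroup.m_closed[OF subgroup, of "g \<otimes> h" "inv h"]
        subgroup.m_inv_closed[OF subgroup, of h]
      by (auto simp: H_carrier G.m_assoc)
    then show ?thesis
      using False that subgroup.m_inv_closed[OF subgroup, of h]
      by (simp add: coset_delta_def H_carrier sigma_zero)
  qed
  moreover have "(\<lambda>C. (ip_norm V (\<delta> v (coset_rep C)))\<^sup>2) summable_on (lcosets H)"
  proof (rule summable_on_cong_neutral[THEN iffD2])
    show "(\<lambda>C. (ip_norm V (\<delta> v (coset_rep C)))\<^sup>2) summable_on {H}" by simp
  qed (use H_lcoset in \<open>auto simp: delta_coset_rep ip_norm_def\<close>)
  ultimately show ?thesis
    using delta_closed[OF v] by (simp add: induced_space_def)
qed

lemma delta_add:
  assumes "v \<in> carrier V" "w \<in> carrier V"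
  shows "\<delta> (v \<oplus>\<^bsub>V\<^esub> w) = \<delta> v \<oplus>\<^bsub>Ind\<^esub> \<delta> w"
  using unitary_mapsD(2)[OF unitary] assms subgroup.m_inv_closed[OF subgroup]
  by (auto simp: coset_delta_def induced_space_def)

lemma delta_smult:
  assumes "v \<in> carrier V"
  shows "\<delta> (c \<odot>\<^bsub>V\<^esub> v) = c \<odot>\<^bsub>Ind\<^esub> \<delta> v"
proof -
  have "c \<odot>\<^bsub>V\<^esub> \<zero>\<^bsub>V\<^esub> = \<zero>\<^bsub>V\<^esub>" using smult_r_null[of c] by (simp add: complex_ring_def)
  then show ?thesis
    using unitary_mapsD(3)[OF unitary] assms subgroup.m_inv_closed[OF subgroup]
    by (auto simp: coset_delta_def induced_space_def)
qed

text \<open>\<open>coset_rep H\<close> is an unspecified element r of \<open>H\<close>, possibly not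
  the identity, but both vectors are moved by the same unitary \<open>\<sigma> (inv r)\<close>, so
  the inner product does not depend on r.\<close>

lemma ip_delta:
  assumes "v \<in> carrier V" "w \<in> carrier V"
  shows "ip Ind (\<delta> v) (\<delta> w) = ip V v w"
proof -
  have r: "coset_rep H \<in> H" using coset_rep_in_H[OF H_lcoset] by simp
  have "ip Ind (\<delta> v) (\<delta> w)
      = (\<Sum>\<^sub>\<infinity>C\<in>lcosets H. ip V (\<delta> v (coset_rep C)) (\<delta> w (coset_rep C)))"
    by (simp add: induced_space_def)
  also have "\<dots> = (\<Sum>\<^sub>\<infinity>C\<in>{H}. ip V (\<delta> v (coset_rep C)) (\<delta> w (coset_rep C)))"
    by (rule infsum_cong_neutral)
      (use H_lcoset in \<open>auto simp: delta_coset_rep\<close>)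
  also have "\<dots> = ip V v w"
    using r assms unitary_mapsD(4)[OF unitary[OF subgroup.m_inv_closed[OF subgroup r]]]
    by (simp add: coset_delta_def H_carrier)
  finally show ?thesis .
qed

text \<open>For x in \<open>H\<close> the left side is
  \<open>\<sigma> (inv x \<otimes> h) v\<close>, which splits by multiplicativity. Thus
  \<open>\<delta>\<close> realizes \<sigma> as a subrepresentation of the restriction of the induced
  representation to \<open>H\<close>.\<close>

lemma induced_rep_delta:
  assumes "v \<in> carrier V" "h \<in> H"
  shows "induced_rep G H V \<sigma> h (\<delta> v) = \<delta> (\<sigma> h v)"
proof
  fix x
  show "induced_rep G H V \<sigma> h (\<delta> v) x = \<delta> (\<sigma> h v) x"
  proof (cases "x \<in> carrier G")
    case x: True
    have h: "h \<in> carrier G" "inv h \<in> H" "inv h \<in> carrier G"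
      using assms(2) subgroup.m_inv_closed[OF subgroup] by (auto simp: H_carrier)
    have "inv h \<otimes> x \<in> H \<longleftrightarrow> x \<in> H"
    proof
      assume "inv h \<otimes> x \<in> H"
      then have "h \<otimes> (inv h \<otimes> x) \<in> H" using assms(2) subgroup.m_closed[OF subgroup] by blast
      then show "x \<in> H" using h x by (simp add: G.m_assoc[symmetric])
    qed (use h subgroup.m_closed[OF subgroup] in blast)
    moreover have "\<sigma> (inv (inv h \<otimes> x)) v = \<sigma> (inv x) (\<sigma> h v)" if "x \<in> H"
      using that assms h x subgroup.m_inv_closed[OF subgroup that]
      by (simp add: G.inv_mult_group sigma_mult)
    ultimately show ?thesis
      using x h assms delta_in_carrier[OF assms(1)]
      by (simp add: induced_rep_def) (simp add: coset_delta_def)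
  qed (use delta_in_carrier[OF assms(1)] in \<open>simp add: induced_rep_def coset_delta_def\<close>)
qed

end

section \<open>Arithmetic of L2 classes\<close>

abbreviation L2_class :: "'a measure \<Rightarrow> ('a \<Rightarrow> complex) \<Rightarrow> ('a \<Rightarrow> complex) set" where
  "L2_class M f \<equiv> ae_eq M `` {f}"

lemma square_integrable_add:
  assumes "f \<in> square_integrable M" "g \<in> square_integrable M"
  shows "(\<lambda>x. f x + g x) \<in> square_integrable M"
proof -
  have [measurable]: "f \<in> borel_measurable M" "g \<in> borel_measurable M"
    using assms by (auto simp: square_integrable_def)
  have "integrable M (\<lambda>x. 2 * (cmod (f x))\<^sup>2 + 2 * (cmod (g x))\<^sup>2)"
    using assms by (auto simp: square_integrable_def)
  then have "integrable M (\<lambda>x. (cmod (f x + g x))\<^sup>2)"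
  proof (rule Bochner_Integration.integrable_bound)
    have "(cmod (f x + g x))\<^sup>2 \<le> 2 * (cmod (f x))\<^sup>2 + 2 * (cmod (g x))\<^sup>2" for x
    proof -
      have "(cmod (f x + g x))\<^sup>2 \<le> (cmod (f x) + cmod (g x))\<^sup>2"
        by (intro power_mono norm_triangle_ineq) auto
      also have "\<dots> \<le> 2 * (cmod (f x))\<^sup>2 + 2 * (cmod (g x))\<^sup>2"
        using zero_le_power2[of "cmod (f x) - cmod (g x)"] by (simp add: power2_eq_square algebra_simps)
      finally show ?thesis .
    qed
    then show "AE x in M. norm ((cmod (f x + g x))\<^sup>2) \<le> norm (2 * (cmod (f x))\<^sup>2 + 2 * (cmod (g x))\<^sup>2)"
      by auto
  qed measurable
  then show ?thesis by (simp add: square_integrable_def)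
qed

lemma square_integrable_mult_left:
  assumes "f \<in> square_integrable M"
  shows "(\<lambda>x. c * f x) \<in> square_integrable M"
  using assms by (auto simp: square_integrable_def norm_mult power_mult_distrib)

lemma square_integrable_zero: "(\<lambda>x. 0) \<in> square_integrable M"
  by (simp add: square_integrable_def)

lemma equiv_ae_eq: "equiv (square_integrable M) (ae_eq M)"
proof (rule equivI)
  show "trans (ae_eq M)"
  proof (rule transI)
    fix f g h assume "(f, g) \<in> ae_eq M" "(g, h) \<in> ae_eq M"
    then show "(f, h) \<in> ae_eq M"
      unfolding ae_eq_def by auto
  qed
  show "sym (ae_eq M)" by (rule symI) (auto simp: ae_eq_def eq_commute)
  show "ae_eq M \<subseteq> square_integrable M \<times> square_integrable M" by (auto simp: ae_eq_def)
  show "refl_on (square_integrable M) (ae_eq M)" by (auto simp: refl_on_def ae_eq_def)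
qed

lemma L2_class_self: "f \<in> square_integrable M \<Longrightarrow> f \<in> L2_class M f"
  by (auto simp: ae_eq_def)

lemma L2_class_eqI: "(f, g) \<in> ae_eq M \<Longrightarrow> L2_class M f = L2_class M g"
  by (rule equiv_class_eq[OF equiv_ae_eq])

lemma L2_carrierE:
  assumes "A \<in> carrier (L2_space M)"
  obtains f where "f \<in> square_integrable M" "A = L2_class M f"
  using assms by (auto simp: L2_space_def elim: quotientE)

lemma L2_class_in_carrier: "f \<in> square_integrable M \<Longrightarrow> L2_class M f \<in> carrier (L2_space M)"
  by (auto simp: L2_space_def intro: quotientI)

text \<open>The sum in \<open>L2_space\<close> is a union over all pairs of representatives. All
  classes in this union coincide and the index sets are nonempty, so the union is one class.\<close>

lemma L2_add:
  assumes "f \<in> square_integrable M" "g \<in> square_integrable M"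
  shows "L2_class M f \<oplus>\<^bsub>L2_space M\<^esub> L2_class M g = L2_class M (\<lambda>x. f x + g x)"
proof -
  have "L2_class M (\<lambda>x. f' x + g' x) = L2_class M (\<lambda>x. f x + g x)"
    if "f' \<in> L2_class M f" "g' \<in> L2_class M g" for f' g'
    by (rule sym, rule L2_class_eqI) (use that in \<open>auto simp: ae_eq_def square_integrable_add\<close>)
  then have "(\<Union>f'\<in>L2_class M f. \<Union>g'\<in>L2_class M g. L2_class M (\<lambda>x. f' x + g' x))
      = (\<Union>f'\<in>L2_class M f. \<Union>g'\<in>L2_class M g. L2_class M (\<lambda>x. f x + g x))"
    by (intro SUP_cong refl)
  also have "\<dots> = L2_class M (\<lambda>x. f x + g x)"
    using L2_class_self[OF assms(1)] L2_class_self[OF assms(2)] by blast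
  finally show ?thesis by (simp add: L2_space_def)
qed

lemma L2_smult:
  assumes "f \<in> square_integrable M"
  shows "c \<odot>\<^bsub>L2_space M\<^esub> L2_class M f = L2_class M (\<lambda>x. c * f x)"
proof -
  have "L2_class M (\<lambda>x. c * f' x) = L2_class M (\<lambda>x. c * f x)" if "f' \<in> L2_class M f" for f'
    by (rule sym, rule L2_class_eqI) (use that in \<open>auto simp: ae_eq_def square_integrable_mult_left\<close>)
  then have "(\<Union>f'\<in>L2_class M f. L2_class M (\<lambda>x. c * f' x))
      = (\<Union>f'\<in>L2_class M f. L2_class M (\<lambda>x. c * f x))"
    by (intro SUP_cong refl)
  also have "\<dots> = L2_class M (\<lambda>x. c * f x)"
    using L2_class_self[OF assms] by blast
  finally show ?thesis by (simp add: L2_space_def)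
qed

text \<open>\<open>the_elem\<close> returns a meaningful value because every choice of
  representatives gives the same integral. The two arguments choose separately even when the class
  is repeated, hence the distinct \<open>f'\<close> and \<open>g'\<close>.\<close>

lemma L2_ip_self:
  assumes "f \<in> square_integrable M"
  shows "ip (L2_space M) (L2_class M f) (L2_class M f) = of_real (LINT x|M. (cmod (f x))\<^sup>2)"
proof -
  have "(LINT x|M. f' x * cnj (g' x)) = of_real (LINT x|M. (cmod (f x))\<^sup>2)"
    if "f' \<in> L2_class M f" "g' \<in> L2_class M f" for f' g'
  proof -
    have "(LINT x|M. f' x * cnj (g' x)) = (LINT x|M. complex_of_real ((cmod (f x))\<^sup>2))"
    proof (rule integral_cong_AE)
      show "AE x in M. f' x * cnj (g' x) = complex_of_real ((cmod (f x))\<^sup>2)"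
        using that unfolding complex_norm_square by (auto simp: ae_eq_def)
      have [measurable]: "cnj \<in> borel_measurable borel"
        by (intro borel_measurable_continuous_onI continuous_intros)
      have [measurable]: "f \<in> borel_measurable M" "f' \<in> borel_measurable M" "g' \<in> borel_measurable M"
        using that by (auto simp: ae_eq_def square_integrable_def)
      show "(\<lambda>x. f' x * cnj (g' x)) \<in> borel_measurable M"
        "(\<lambda>x. complex_of_real ((cmod (f x))\<^sup>2)) \<in> borel_measurable M"
        by measurable
    qed
    then show ?thesis by (simp only: integral_complex_of_real)
  qed
  then have "(\<Union>f'\<in>L2_class M f. \<Union>g'\<in>L2_class M f. {LINT x|M. f' x * cnj (g' x)})
      = (\<Union>f'\<in>L2_class M f. \<Union>g'\<in>L2_class M f. {complex_of_real (LINT x|M. (cmod (f x))\<^sup>2)})"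
    by (intro SUP_cong refl) simp
  also have "\<dots> = {complex_of_real (LINT x|M. (cmod (f x))\<^sup>2)}"
    using L2_class_self[OF assms] by blast
  finally show ?thesis by (simp add: L2_space_def)
qed

section \<open>Weighted composition operators\<close>

text \<open>For x > 0 the factor x^(is) has modulus one; this is where \<open>s\<close> disappears.
  At x = 0 both sides vanish, since \<open>0 powr w = 0\<close>.\<close>

lemma cmod_of_real_powr_half:
  assumes "0 \<le> x"
  shows "(cmod (of_real x powr Complex (1/2) s))\<^sup>2 = x"
  using assms by (cases "x = 0") (simp_all add: norm_powr_real_powr powr_half_sqrt)

text \<open>The squared modulus of the weight is the Radon-Nikodym derivative itself, so the
  integral turns into one against the pushforward, and then into one over the source by change of
  variables. The set \<open>B\<close> allows mass to be followed into a small set.\<close>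

lemma (in finite_measure) nn_integral_weighted_composition:
  fixes f :: "'a \<Rightarrow> complex"
  assumes \<gamma> [measurable]: "\<gamma> \<in> measurable M M" and \<gamma>' [measurable]: "\<gamma>' \<in> measurable M M"
    and inv: "\<And>x. x \<in> space M \<Longrightarrow> \<gamma>' (\<gamma> x) = x"
    and ac: "absolutely_continuous M (distr M M \<gamma>)"
    and f [measurable]: "f \<in> borel_measurable M"
    and B [measurable]: "B \<in> sets M"
  shows "(\<integral>\<^sup>+z. ennreal ((cmod (of_real (enn2real (RN_deriv M (distr M M \<gamma>) z)) powr Complex (1/2) s
            * f (\<gamma>' z)))\<^sup>2) * indicator B z \<partial>M)
       = (\<integral>\<^sup>+x. ennreal ((cmod (f x))\<^sup>2) * indicator B (\<gamma> x) \<partial>M)"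
proof -
  let ?N = "distr M M \<gamma>"
  interpret N: finite_measure ?N by (rule finite_measure_distr) measurable
  \<comment> \<open>\<open>enn2real\<close> sends \<infinity> to 0, so the density can be recovered
    only where it is finite.\<close>
  have "AE z in M. RN_deriv M ?N z \<noteq> \<infinity>"
    by (rule RN_deriv_finite) (use ac in \<open>auto intro: N.sigma_finite_measure_axioms\<close>)
  then have "AE z in M. ennreal ((cmod (of_real (enn2real (RN_deriv M ?N z)) powr Complex (1/2) s
            * f (\<gamma>' z)))\<^sup>2) * indicator B z
        = RN_deriv M ?N z * (ennreal ((cmod (f (\<gamma>' z)))\<^sup>2) * indicator B z)"
  proof eventually_elim
    case (elim z)
    then show ?case
      by (simp add: norm_mult power_mult_distrib cmod_of_real_powr_half ennreal_mult ennreal_enn2real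
          less_top mult.assoc)
  qed
  then have "(\<integral>\<^sup>+z. ennreal ((cmod (of_real (enn2real (RN_deriv M ?N z)) powr Complex (1/2) s
            * f (\<gamma>' z)))\<^sup>2) * indicator B z \<partial>M)
      = (\<integral>\<^sup>+z. RN_deriv M ?N z * (ennreal ((cmod (f (\<gamma>' z)))\<^sup>2) * indicator B z) \<partial>M)"
    by (rule nn_integral_cong_AE)
  also have "\<dots> = (\<integral>\<^sup>+z. ennreal ((cmod (f (\<gamma>' z)))\<^sup>2) * indicator B z \<partial>?N)"
    by (rule RN_deriv_nn_integral[symmetric]) (use ac in auto)
  also have "\<dots> = (\<integral>\<^sup>+x. ennreal ((cmod (f (\<gamma>' (\<gamma> x))))\<^sup>2) * indicator B (\<gamma> x) \<partial>M)"
    by (rule nn_integral_distr) measurable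
  also have "\<dots> = (\<integral>\<^sup>+x. ennreal ((cmod (f x))\<^sup>2) * indicator B (\<gamma> x) \<partial>M)"
    by (rule nn_integral_cong) (simp add: inv)
  finally show ?thesis .
qed

text \<open>By Borel-Cantelli almost every point lies in only finitely many \<open>C n\<close>, so
  the integrands tend to 0 almost everywhere, dominated by \<open>h\<close>.\<close>

lemma (in finite_measure) nn_integral_shrinking_sets:
  assumes h [measurable]: "h \<in> borel_measurable M" and fin: "(\<integral>\<^sup>+x. h x \<partial>M) < \<infinity>"
    and C [measurable]: "\<And>n. C n \<in> sets M"
    and small: "summable (\<lambda>n. measure M (C n))"
  shows "(\<lambda>n. \<integral>\<^sup>+x. h x * indicator (C n) x \<partial>M) \<longlonglongrightarrow> 0"
proof -
  have "AE x in M. eventually (\<lambda>n. x \<in> space M - C n) sequentially"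
    by (rule borel_cantelli_AE1[OF _ _ small]) (auto simp: less_top[symmetric])
  then have lim: "AE x in M. (\<lambda>n. h x * indicator (C n) x) \<longlonglongrightarrow> 0"
  proof eventually_elim
    case (elim x)
    then have "eventually (\<lambda>n. h x * indicator (C n) x = 0) sequentially"
      by eventually_elim simp
    then show ?case by (rule tendsto_eventually)
  qed
  have "(\<lambda>n. \<integral>\<^sup>+x. h x * indicator (C n) x \<partial>M) \<longlonglongrightarrow> (\<integral>\<^sup>+x. 0 \<partial>M)"
    by (rule nn_integral_dominated_convergence[where w = h])
      (use fin lim in \<open>auto simp: indicator_def\<close>)
  then show ?thesis by simp
qed

section \<open>A piecewise linear map squeezing most of the interval\<close>

lemma dyadic_rationalsI: "x = of_int m / 2 ^ n \<Longrightarrow> x \<in> dyadic_rationals"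
  by (auto simp: dyadic_rationals_def)

lemma dyadic_rationals_of_int [simp]: "of_int m \<in> dyadic_rationals"
  by (rule dyadic_rationalsI[of _ m 0]) simp

lemma dyadic_rationals_0 [simp]: "0 \<in> dyadic_rationals"
  and dyadic_rationals_1 [simp]: "1 \<in> dyadic_rationals"
  using dyadic_rationals_of_int[of 0] dyadic_rationals_of_int[of 1] by simp_all

lemma dyadic_rationals_add [intro]:
  assumes "x \<in> dyadic_rationals" "y \<in> dyadic_rationals"
  shows "x + y \<in> dyadic_rationals"
proof -
  obtain m n k l where "x = of_int m / 2 ^ n" "y = of_int k / 2 ^ l"
    using assms by (auto simp: dyadic_rationals_def)
  then have "x + y = of_int (m * 2 ^ l + k * 2 ^ n) / 2 ^ (n + l)"
    by (simp add: power_add add_divide_distrib)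
  then show ?thesis by (rule dyadic_rationalsI)
qed

lemma dyadic_rationals_mult [intro]:
  assumes "x \<in> dyadic_rationals" "y \<in> dyadic_rationals"
  shows "x * y \<in> dyadic_rationals"
proof -
  obtain m n k l where "x = of_int m / 2 ^ n" "y = of_int k / 2 ^ l"
    using assms by (auto simp: dyadic_rationals_def)
  then have "x * y = of_int (m * k) / 2 ^ (n + l)"
    by (simp add: power_add)
  then show ?thesis by (rule dyadic_rationalsI)
qed

lemma dyadic_rationals_minus [intro]: "x \<in> dyadic_rationals \<Longrightarrow> - x \<in> dyadic_rationals"
  using dyadic_rationals_mult[of "of_int (- 1)" x] dyadic_rationals_of_int[of "- 1"] by simp

lemma dyadic_rationals_diff [intro]:
  "x \<in> dyadic_rationals \<Longrightarrow> y \<in> dyadic_rationals \<Longrightarrow> x - y \<in> dyadic_rationals"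
  using dyadic_rationals_add[of x "- y"] dyadic_rationals_minus[of y] by simp

lemma dyadic_rationals_two_power: "2 ^ k \<in> dyadic_rationals"
  using dyadic_rationals_of_int[of "2 ^ k"] by simp

lemma dyadic_rationals_half_power: "1 / 2 ^ k \<in> dyadic_rationals"
  by (rule dyadic_rationalsI[of _ 1 k]) simp

text \<open>This map is the identity up to \<open>e\<^sup>2\<close>, has slope \<open>e\<close> up to \<open>1 - e + e\<^sup>2\<close> and slope \<open>1 / e\<close>
  afterwards, so it sends \<open>{e\<^sup>2..1 - e + e\<^sup>2}\<close> onto \<open>{e\<^sup>2..e}\<close>. The breakpoints are chosen so that the
  last two pieces exchange the lengths \<open>1 - e\<close> and \<open>e - e\<^sup>2\<close>; hence all data are dyadic for
  \<open>e = 1 / 2 ^ k\<close>, and elements of \<open>F\<close> arise.\<close>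

definition squeeze :: "real \<Rightarrow> real \<Rightarrow> real" where
  "squeeze e x = max (min x (e\<^sup>2 + e * (x - e\<^sup>2))) (1 - (1 - x) / e)"

text \<open>The inverse on the whole real line: its breakpoints e^2 and e are the images of those of
  \<open>squeeze\<close>, and its slopes are 1, 1/e and e.\<close>

definition unsqueeze :: "real \<Rightarrow> real \<Rightarrow> real" where
  "unsqueeze e y = (if y \<le> e\<^sup>2 then y else if y \<le> e then e\<^sup>2 + (y - e\<^sup>2) / e else 1 - e * (1 - y))"

context
  fixes e :: real
  assumes e: "0 < e" "e \<le> 1/2"
begin

lemma squeeze_breaks: "0 < e\<^sup>2" "e\<^sup>2 < e" "e\<^sup>2 < 1 - e + e\<^sup>2" "1 - e + e\<^sup>2 < 1" "e < 1"
proof -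
  have "e * e \<le> e * (1/2)" using e by (intro mult_left_mono) auto
  then show "0 < e\<^sup>2" "e\<^sup>2 < e" "e\<^sup>2 < 1 - e + e\<^sup>2" "1 - e + e\<^sup>2 < 1" "e < 1"
    using e by (auto simp: power2_eq_square)
qed

text \<open>Written around the second breakpoint 1 - e + e^2, where the last two affine pieces share
  the value e, comparing the pieces becomes comparing their slopes 1/e and e.\<close>

lemma squeeze_right_eq: "1 - (1 - x) / e = e + (x - (1 - e + e\<^sup>2)) / e"
  using e by (simp add: field_simps power2_eq_square)

lemma squeeze_middle_eq: "e\<^sup>2 + e * (x - e\<^sup>2) = e + e * (x - (1 - e + e\<^sup>2))"
  by (simp add: algebra_simps power2_eq_square)

lemma squeeze_left:
  assumes "x \<le> e\<^sup>2"
  shows "squeeze e x = x"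
proof -
  have "e * (e\<^sup>2 - x) \<le> 1 * (e\<^sup>2 - x)"
    using assms e by (intro mult_right_mono) auto
  moreover have "1 - x \<le> (1 - x) / e"
    using assms squeeze_breaks e by (simp add: le_divide_eq mult_left_le)
  ultimately show ?thesis by (simp add: squeeze_def algebra_simps)
qed

lemma squeeze_middle:
  assumes "e\<^sup>2 \<le> x" "x \<le> 1 - e + e\<^sup>2"
  shows "squeeze e x = e\<^sup>2 + e * (x - e\<^sup>2)"
proof -
  have "e * (x - e\<^sup>2) \<le> 1 * (x - e\<^sup>2)"
    using assms e by (intro mult_right_mono) auto
  then have "e\<^sup>2 + e * (x - e\<^sup>2) \<le> x" by simp
  moreover have "(x - (1 - e + e\<^sup>2)) / e \<le> e * (x - (1 - e + e\<^sup>2))"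
  proof -
    define t where "t = (1 - e + e\<^sup>2) - x"
    have t: "0 \<le> t" using assms by (simp add: t_def)
    have "e * t * e \<le> 1 * t * 1" using e t by (intro mult_mono) auto
    then have "e * t \<le> t / e" using e by (simp add: le_divide_eq)
    moreover have "x - (1 - e + e\<^sup>2) = - t" by (simp add: t_def)
    ultimately show ?thesis by (simp only:)
  qed
  then have "1 - (1 - x) / e \<le> e\<^sup>2 + e * (x - e\<^sup>2)"
    unfolding squeeze_right_eq squeeze_middle_eq by (rule add_left_mono)
  ultimately show ?thesis by (simp add: squeeze_def)
qed

lemma squeeze_right:
  assumes "1 - e + e\<^sup>2 \<le> x"
  shows "squeeze e x = 1 - (1 - x) / e"
proof -
  define t where "t = x - (1 - e + e\<^sup>2)"
  have t: "0 \<le> t" using assms by (simp add: t_def)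
  have "e * t * e \<le> 1 * t * 1" using e t by (intro mult_mono) auto
  then have "e * t \<le> t / e" using e by (simp add: le_divide_eq)
  then show ?thesis unfolding squeeze_def squeeze_right_eq
    using squeeze_middle_eq[of x] by (simp add: t_def)
qed

lemma unsqueeze_squeeze: "unsqueeze e (squeeze e x) = x"
proof -
  consider "x \<le> e\<^sup>2" | "e\<^sup>2 < x" "x \<le> 1 - e + e\<^sup>2" | "1 - e + e\<^sup>2 < x" by linarith
  then show ?thesis
  proof cases
    case 1
    then show ?thesis by (simp add: squeeze_left unsqueeze_def)
  next
    case 2
    define y where "y = squeeze e x"
    have y: "y = e\<^sup>2 + e * (x - e\<^sup>2)" using 2 by (simp add: y_def squeeze_middle)
    have "0 < e * (x - e\<^sup>2)" "e * (x - (1 - e + e\<^sup>2)) \<le> 0"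
      using 2 e by (auto simp: mult_le_0_iff)
    then have "e\<^sup>2 < y" "y \<le> e" using y squeeze_middle_eq[of x] by linarith+
    moreover have "(y - e\<^sup>2) / e = x - e\<^sup>2" using y e by simp
    ultimately show ?thesis by (simp add: unsqueeze_def y_def[symmetric])
  next
    case 3
    then have "0 < (x - (1 - e + e\<^sup>2)) / e" using e by simp
    then have "e < squeeze e x" using 3 by (simp add: squeeze_right squeeze_right_eq)
    then show ?thesis
      using 3 e squeeze_breaks by (simp add: squeeze_right unsqueeze_def)
  qed
qed

lemma squeeze_unsqueeze: "squeeze e (unsqueeze e y) = y"
proof -
  consider "y \<le> e\<^sup>2" | "e\<^sup>2 < y" "y \<le> e" | "e < y" by linarith
  then show ?thesis
  proof cases
    case 1
    then show ?thesis by (simp add: squeeze_left unsqueeze_def)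
  next
    case 2
    have "(y - e\<^sup>2) / e \<le> (e - e\<^sup>2) / e" using 2 e by (intro divide_right_mono) auto
    also have "\<dots> = 1 - e" using e by (simp add: diff_divide_distrib power2_eq_square)
    finally have "(y - e\<^sup>2) / e \<le> 1 - e" .
    moreover have "0 < (y - e\<^sup>2) / e" using 2 e by simp
    ultimately show ?thesis using 2 e by (simp add: unsqueeze_def squeeze_middle)
  next
    case 3
    have "e * (1 - y) \<le> e * (1 - e)" using 3 e by (intro mult_left_mono) auto
    then have "1 - e + e\<^sup>2 \<le> 1 - e * (1 - y)" by (simp add: algebra_simps power2_eq_square)
    then show ?thesis using 3 e squeeze_breaks by (simp add: unsqueeze_def squeeze_right)
  qed
qed

lemma squeeze_less: "x < y \<Longrightarrow> squeeze e x < squeeze e y"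
proof -
  assume "x < y"
  then have "e * (x - e\<^sup>2) < e * (y - e\<^sup>2)" "(1 - y) / e < (1 - x) / e"
    using e by (auto simp: divide_strict_right_mono)
  then show ?thesis using \<open>x < y\<close> unfolding squeeze_def by linarith
qed

lemma squeeze_less_iff: "squeeze e x < squeeze e y \<longleftrightarrow> x < y"
  using squeeze_less[of x y] squeeze_less[of y x] by (metis less_asym less_linear)

lemma squeeze_le_iff: "squeeze e x \<le> squeeze e y \<longleftrightarrow> x \<le> y"
  using squeeze_less_iff[of y x] by linarith

lemma squeeze_0: "squeeze e 0 = 0" and squeeze_1: "squeeze e 1 = 1"
  using squeeze_breaks squeeze_left[of 0] squeeze_right[of 1] by auto

lemma squeeze_in_unit_iff: "squeeze e x \<in> {0..1} \<longleftrightarrow> x \<in> {0..1}"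
  using squeeze_le_iff[of 0 x] squeeze_le_iff[of x 1] by (simp add: squeeze_0 squeeze_1)

lemma unsqueeze_in_unit_iff: "unsqueeze e y \<in> {0..1} \<longleftrightarrow> y \<in> {0..1}"
  using squeeze_in_unit_iff[of "unsqueeze e y"] by (simp add: squeeze_unsqueeze)

lemma continuous_on_squeeze: "continuous_on S (squeeze e)"
  unfolding squeeze_def[abs_def] using e by (intro continuous_intros) auto

text \<open>For absolute continuity it is enough that each value comes from one of three nonconstant
  affine maps, without deciding which piece contains \<open>x\<close>.\<close>

lemma squeeze_cases: "squeeze e x \<in> {x, e\<^sup>2 + e * (x - e\<^sup>2), 1 - (1 - x) / e}"
  by (simp add: squeeze_def max_def min_def)

text \<open>The strict inequality \<open>u < v\<close> matters: on a nondegenerate interval even a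
  one-sided derivative at an endpoint is unique.\<close>

lemma squeeze_eq_affine:
  assumes "x \<in> {0..1}"
  obtains u v m c where "u < v" "{u..v} \<subseteq> {0..1}" "x \<in> {u..v}"
    "m = 1 \<or> m = e \<or> m = 1 / e" "\<And>y. y \<in> {u..v} \<Longrightarrow> squeeze e y = m * y + c"
proof -
  consider "x \<le> e\<^sup>2" | "e\<^sup>2 < x" "x \<le> 1 - e + e\<^sup>2" | "1 - e + e\<^sup>2 < x" by linarith
  then show ?thesis
  proof cases
    case 1
    then show ?thesis
      using assms squeeze_breaks by (intro that[of 0 "e\<^sup>2" 1 0]) (auto simp: squeeze_left)
  next
    case 2
    show ?thesis
      by (rule that[of "e\<^sup>2" "1 - e + e\<^sup>2" e "e\<^sup>2 - e * e\<^sup>2"])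
        (use 2 squeeze_breaks in \<open>auto simp: squeeze_middle algebra_simps\<close>)
  next
    case 3
    then show ?thesis
      using assms squeeze_breaks
      by (intro that[of "1 - e + e\<^sup>2" 1 "1 / e" "1 - 1 / e"])
        (auto simp: squeeze_right diff_divide_distrib)
  qed
qed

lemma squeeze_affine_between_breaks:
  assumes "{u<..<v} \<inter> {e\<^sup>2, 1 - e + e\<^sup>2} = {}"
  shows "\<exists>m c. \<forall>x\<in>{u..v}. squeeze e x = m * x + c"
proof -
  have "(v \<le> e\<^sup>2) \<or> (e\<^sup>2 \<le> u \<and> v \<le> 1 - e + e\<^sup>2) \<or> (1 - e + e\<^sup>2 \<le> u) \<or> v \<le> u"
    using assms squeeze_breaks by (auto simp: not_less) 
  then show ?thesis
  proof (elim disjE conjE)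
    assume "v \<le> e\<^sup>2"
    then show ?thesis by (intro exI[of _ 1] exI[of _ 0]) (auto simp: squeeze_left)
  next
    assume "e\<^sup>2 \<le> u" "v \<le> 1 - e + e\<^sup>2"
    then show ?thesis
      by (intro exI[of _ e] exI[of _ "e\<^sup>2 - e * e\<^sup>2"]) (auto simp: squeeze_middle algebra_simps)
  next
    assume "1 - e + e\<^sup>2 \<le> u"
    then show ?thesis
      by (intro exI[of _ "1 / e"] exI[of _ "1 - 1 / e"]) (auto simp: squeeze_right diff_divide_distrib)
  next
    \<comment> \<open>Here the open interval is empty whatever the breakpoints are, and the closed
      one has at most one point, so a constant serves.\<close>
    assume "v \<le> u"
    then have "\<forall>x\<in>{u..v}. squeeze e x = 0 * x + squeeze e u"
      by (metis add_0 antisym atLeastAtMost_iff mult_zero_left order_trans)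
    then show ?thesis by blast
  qed
qed

lemma squeeze_differentiable:
  assumes "x \<notin> {e\<^sup>2, 1 - e + e\<^sup>2}"
  shows "squeeze e differentiable (at x)"
proof -
  have *: "squeeze e differentiable (at x)"
    if "open S" "x \<in> S" "\<And>y. y \<in> S \<Longrightarrow> squeeze e y = m * y + c" for S m c
  proof -
    have "((\<lambda>y. m * y + c) has_real_derivative m) (at x)" by (auto intro!: derivative_eq_intros)
    then have "(squeeze e has_real_derivative m) (at x)"
      using DERIV_cong_ev[of x x "squeeze e" "\<lambda>y. m * y + c" m m] that
      by (simp add: eventually_nhds_in_open eventually_mono[OF eventually_nhds_in_open[OF that(1,2)]])
    then show ?thesis by (auto simp: real_differentiable_def)
  qed
  consider "x < e\<^sup>2" | "e\<^sup>2 < x" "x < 1 - e + e\<^sup>2" | "1 - e + e\<^sup>2 < x" using assms by force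
  then show ?thesis
  proof cases
    case 1
    then show ?thesis by (intro *[of "{..<e\<^sup>2}" 1 0]) (auto simp: squeeze_left)
  next
    case 2
    then show ?thesis
      by (intro *[of "{e\<^sup>2<..<1 - e + e\<^sup>2}" e "e\<^sup>2 - e * e\<^sup>2"]) (auto simp: squeeze_middle algebra_simps)
  next
    case 3
    then show ?thesis
      by (intro *[of "{1 - e + e\<^sup>2<..}" "1 / e" "1 - 1 / e"]) (auto simp: squeeze_right diff_divide_distrib)
  qed
qed

text \<open>Restricting the derivative to an affine piece that contains \<open>x\<close> identifies
  it with the slope of that piece. This also covers a supposed derivative at a breakpoint and the
  one-sided derivatives at 0 and 1.\<close>

lemma squeeze_derivative:
  assumes "x \<in> {0..1}" "(squeeze e has_real_derivative d) (at x within {0..1})"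
  shows "d = 1 \<or> d = e \<or> d = 1 / e"
proof -
  obtain u v m c where uv: "u < v" "{u..v} \<subseteq> {0..1}" "x \<in> {u..v}" and m: "m = 1 \<or> m = e \<or> m = 1 / e"
    and eq: "\<And>y. y \<in> {u..v} \<Longrightarrow> squeeze e y = m * y + c"
    using squeeze_eq_affine[OF assms(1)] by metis
  have "(squeeze e has_real_derivative d) (at x within {u..v})"
    using assms(2) uv(2) by (rule DERIV_subset)
  moreover have "(squeeze e has_real_derivative m) (at x within {u..v})"
  proof (rule has_field_derivative_transform_within[of "\<lambda>y. m * y + c" m x "{u..v}" 1])
    show "((\<lambda>y. m * y + c) has_real_derivative m) (at x within {u..v})"
      by (auto intro!: derivative_eq_intros)
  qed (use uv eq in auto)
  ultimately have "d = m"
    using vector_derivative_unique_within_closed_interval[of u v x "squeeze e" d m] uv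
    by (simp add: has_real_derivative_iff_has_vector_derivative)
  then show ?thesis using m by simp
qed

end

text \<open>Division by e is multiplication by 2^k, so all pieces have dyadic coefficients. The
  claim about the inverse gives that \<open>squeeze\<close> maps the dyadic points of the unit
  interval onto themselves.\<close>

lemma squeeze_dyadic:
  assumes "x \<in> dyadic_rationals"
  shows "squeeze (1 / 2 ^ k) x \<in> dyadic_rationals" "unsqueeze (1 / 2 ^ k) x \<in> dyadic_rationals"
proof -
  define e :: real where "e = 1 / 2 ^ k"
  have e: "e \<in> dyadic_rationals" unfolding e_def by (rule dyadic_rationals_half_power)
  have q: "y / e \<in> dyadic_rationals" if "y \<in> dyadic_rationals" for y
    using dyadic_rationals_mult[OF that dyadic_rationals_two_power[of k]] by (simp add: e_def)
  show "squeeze (1 / 2 ^ k) x \<in> dyadic_rationals" "unsqueeze (1 / 2 ^ k) x \<in> dyadic_rationals"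
    unfolding squeeze_def unsqueeze_def max_def min_def power2_eq_square e_def[symmetric]
    using assms e
    by (auto split: if_split intro!: dyadic_rationals_add dyadic_rationals_diff dyadic_rationals_mult q)
qed

lemma squeeze_in_thompson_F:
  assumes "1 \<le> k"
  shows "restrict (squeeze (1 / 2 ^ k)) {0..1} \<in> thompson_F"
proof -
  define e :: real where "e = 1 / 2 ^ k"
  have "(2::real) ^ 1 \<le> 2 ^ k" using assms by (intro power_increasing) auto
  then have e: "0 < e" "e \<le> 1/2" by (auto simp: e_def field_simps)
  let ?\<phi> = "restrict (squeeze e) {0..1}"
  note [simp] = unsqueeze_squeeze[OF e] squeeze_unsqueeze[OF e]
  have in01: "squeeze e x \<in> {0..1}" "unsqueeze e x \<in> {0..1}" if "x \<in> {0..1}" for x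
    using that squeeze_in_unit_iff[OF e] unsqueeze_in_unit_iff[OF e] by blast+
  have img: "?\<phi> ` {0..1} = {0..1}"
  proof
    show "{0..1} \<subseteq> ?\<phi> ` {0..1}"
    proof
      fix y :: real assume "y \<in> {0..1}"
      then show "y \<in> ?\<phi> ` {0..1}" using in01(2)[of y] by (intro image_eqI[of _ _ "unsqueeze e y"]) auto
    qed
  qed (use in01(1) in auto)
  have cont: "continuous_on {0..1} ?\<phi>"
    by (rule continuous_on_eq[OF continuous_on_squeeze[OF e]]) simp
  have mono: "strict_mono_on {0..1} ?\<phi>"
    by (auto simp: strict_mono_on_def squeeze_less[OF e])
  have "\<exists>\<psi>. homeomorphism {0..1} {0..1} ?\<phi> \<psi>"
    using homeomorphism_compact[OF _ cont img strict_mono_on_imp_inj_on[OF mono]] by auto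
  moreover have "piecewise_linear_on {0..1} ?\<phi>"
    unfolding piecewise_linear_on_def
  proof (intro exI[of _ "{e\<^sup>2, 1 - e + e\<^sup>2}"] conjI allI impI)
    fix u v assume uv: "{u..v} \<subseteq> {0..1} \<and> {u<..<v} \<inter> {e\<^sup>2, 1 - e + e\<^sup>2} = {}"
    then obtain m c where "\<forall>x\<in>{u..v}. squeeze e x = m * x + c"
      using squeeze_affine_between_breaks[OF e] by blast
    then show "\<exists>m c. \<forall>x\<in>{u..v}. ?\<phi> x = m * x + c"
      using uv by (intro exI[of _ m] exI[of _ c]) auto
  qed simp
  moreover have "?\<phi> ` (dyadic_rationals \<inter> {0..1}) = dyadic_rationals \<inter> {0..1}"
  proof
    show "?\<phi> ` (dyadic_rationals \<inter> {0..1}) \<subseteq> dyadic_rationals \<inter> {0..1}"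
      using in01(1) squeeze_dyadic(1) by (auto simp: e_def)
    show "dyadic_rationals \<inter> {0..1} \<subseteq> ?\<phi> ` (dyadic_rationals \<inter> {0..1})"
    proof
      fix y assume "y \<in> dyadic_rationals \<inter> {0..1}"
      then show "y \<in> ?\<phi> ` (dyadic_rationals \<inter> {0..1})"
        using in01(2)[of y] squeeze_dyadic(2)[of y k]
        by (intro image_eqI[of _ _ "unsqueeze e y"]) (auto simp: e_def[symmetric])
    qed
  qed
  moreover have nd: "{x\<in>{0..1}. \<not> ?\<phi> differentiable (at x within {0..1})} \<subseteq> {e\<^sup>2, 1 - e + e\<^sup>2}"
  proof (rule ccontr)
    assume "\<not> ?thesis"
    then obtain x where x: "x \<in> {0..1}" "\<not> ?\<phi> differentiable (at x within {0..1})"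
      "x \<notin> {e\<^sup>2, 1 - e + e\<^sup>2}" by auto
    have "squeeze e differentiable (at x within {0..1})"
      using squeeze_differentiable[OF e x(3)] differentiable_at_withinI by blast
    then have "?\<phi> differentiable (at x within {0..1})"
      by (rule differentiable_transform_within[of _ _ _ 1]) (use x in auto)
    then show False using x by simp
  qed
  moreover have "{e\<^sup>2, 1 - e + e\<^sup>2} \<subseteq> dyadic_rationals"
  proof -
    have "e \<in> dyadic_rationals" unfolding e_def by (rule dyadic_rationals_half_power)
    then show ?thesis unfolding power2_eq_square
      by (auto intro!: dyadic_rationals_add dyadic_rationals_diff dyadic_rationals_mult)
  qed
  moreover have "\<exists>j::int. d = 2 powi j"
    if x: "x \<in> {0..1}" and d: "(?\<phi> has_real_derivative d) (at x within {0..1})" for x d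
  proof -
    have "(squeeze e has_real_derivative d) (at x within {0..1})"
      by (rule has_field_derivative_transform_within[OF d, of 1]) (use x in auto)
    then have "d = 1 \<or> d = e \<or> d = 1 / e" by (rule squeeze_derivative[OF e x])
    moreover have "(1::real) = 2 powi 0" "e = 2 powi (- int k)" "1 / e = 2 powi (int k)"
      by (simp_all add: e_def power_int_minus inverse_eq_divide)
    ultimately show ?thesis by metis
  qed
  ultimately show ?thesis
    unfolding thompson_F_def e_def[symmetric] using mono finite_subset[OF nd] by auto
qed

section \<open>The measure on the circle\<close>

lemma eta_add: "eta (x + y) = eta x * eta y"
  by (simp add: eta_def distrib_left exp_add)

lemma eta_eq_cis: "eta t = cis (2 * pi * t)"
  by (simp add: eta_def cis_conv_exp mult_ac)

lemma eta_eq_iff: "eta x = eta y \<longleftrightarrow> (\<exists>n::int. x = y + of_int n)"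
proof -
  have "eta x = eta y \<longleftrightarrow> (\<exists>n::int. 2 * complex_of_real pi * \<i> * of_real x
      = 2 * complex_of_real pi * \<i> * of_real y + (of_int (2 * n) * pi) * \<i>)"
    unfolding eta_def by (rule exp_eq)
  also have "\<dots> \<longleftrightarrow> (\<exists>n::int. x = y + of_int n)"
  proof (rule ex_cong1)
    fix n :: int
    have "2 * complex_of_real pi * \<i> * of_real x
        = 2 * complex_of_real pi * \<i> * of_real y + (of_int (2 * n) * pi) * \<i>
      \<longleftrightarrow> 2 * complex_of_real pi * \<i> * of_real x
        = 2 * complex_of_real pi * \<i> * of_real (y + of_int n)"
      by (simp add: algebra_simps)
    also have "\<dots> \<longleftrightarrow> x = y + of_int n"
      by (simp del: of_real_add)
    finally show "2 * complex_of_real pi * \<i> * of_real x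
        = 2 * complex_of_real pi * \<i> * of_real y + (of_int (2 * n) * pi) * \<i>
      \<longleftrightarrow> x = y + of_int n" .
  qed
  finally show ?thesis .
qed

lemma norm_eta [simp]: "cmod (eta t) = 1"
  by (simp add: eta_eq_cis)

lemma eta_int_add [simp]: "eta (x + of_int n) = eta x"
  by (auto simp: eta_eq_iff)

lemma eta_frac [simp]: "eta (frac x) = eta x"
  using eta_int_add[of "frac x" "\<lfloor>x\<rfloor>"] by (simp add: frac_def)

lemma eta_add_frac [simp]: "eta (a + frac x) = eta (a + x)"
  by (simp add: eta_add)

lemma frac_of_unit: "0 \<le> x \<Longrightarrow> x < 1 \<Longrightarrow> frac x = x"
  by (simp add: frac_eq)

definition angle :: "complex \<Rightarrow> real" where
  "angle z = Arg2pi z / (2 * pi)"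

lemma angle_eta [simp]: "angle (eta t) = frac t"
proof -
  have "Arg2pi (eta (frac t)) = 2 * pi * frac t"
    by (rule Arg2pi_unique[of 1]) (auto simp: eta_def mult_ac frac_lt_1)
  then show ?thesis by (simp add: angle_def)
qed

lemma angle_bounds: "0 \<le> angle z" "angle z < 1"
  using Arg2pi[of z] by (auto simp: angle_def)

lemma eta_angle: "z \<in> circle \<Longrightarrow> eta (angle z) = z"
  using Arg2pi_eq[of z] by (simp add: eta_def angle_def mult_ac)

lemma circle_etaE:
  assumes "z \<in> circle"
  obtains t where "0 \<le> t" "t < 1" "z = eta t"
  using eta_angle[OF assms] angle_bounds[of z] that by metis

lemma continuous_on_eta: "continuous_on S eta"
  unfolding eta_def[abs_def] by (intro continuous_intros)

lemma space_nu [simp]: "space nu = circle"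
  by (simp add: nu_def space_restrict_space)

lemma sets_nu: "sets nu = sets (restrict_space borel circle)"
  by (simp add: nu_def)

lemma measurable_nu: "measurable nu nu = measurable (restrict_space borel circle) (restrict_space borel circle)"
  by (rule measurable_cong_sets) (simp_all add: sets_nu)

lemma eta_measurable [measurable]: "eta \<in> measurable borel (restrict_space borel circle)"
  by (rule measurable_restrict_space2)
    (auto intro: borel_measurable_continuous_onI[OF continuous_on_eta])

lemma eta_measurable_unit [measurable]:
  "eta \<in> measurable (restrict_space lborel {0..1}) (restrict_space borel circle)"
  using measurable_restrict_space1[OF eta_measurable, of "{0..1}"]
  by (simp cong: measurable_cong_sets add: sets_restrict_space)

lemma emeasure_nu:
  assumes "A \<in> sets nu"
  shows "emeasure nu A = emeasure lborel {t\<in>{0..1}. eta t \<in> A}"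
proof -
  have A: "A \<in> sets (restrict_space borel circle)" using assms by (simp add: sets_nu)
  have "emeasure nu A
      = emeasure (restrict_space lborel {0..1}) (eta -` A \<inter> space (restrict_space lborel {0..1}))"
    unfolding nu_def by (rule emeasure_distr[OF eta_measurable_unit A])
  also have "\<dots> = emeasure lborel (eta -` A \<inter> space (restrict_space lborel {0..1}))"
    by (rule emeasure_restrict_space) (auto simp: space_restrict_space)
  also have "eta -` A \<inter> space (restrict_space lborel {0..1}) = {t\<in>{0..1}. eta t \<in> A}"
    by (auto simp: space_restrict_space)
  finally show ?thesis .
qed

lemma finite_measure_nu: "finite_measure nu"
proof
  have "emeasure nu (space nu) = emeasure lborel {0..1::real}"
    using emeasure_nu[OF sets.top] by (simp flip: atLeastAtMost_def atLeastAtMost_iff)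
  then show "emeasure nu (space nu) \<noteq> \<infinity>" by simp
qed

lemma closed_in_sets_nu: "closed A \<Longrightarrow> A \<subseteq> circle \<Longrightarrow> A \<in> sets nu"
  by (subst sets_nu, subst sets_restrict_space_iff) auto

lemma closed_eta_image: "closed (eta ` {u..v})"
  by (intro compact_imp_closed compact_continuous_image continuous_on_eta compact_Icc)

lemma eta_image_in_sets_nu: "eta ` {u..v} \<in> sets nu"
  by (intro closed_in_sets_nu closed_eta_image) auto

text \<open>An arc may run past angle 1, hence the range up to 2. If x is in [0,2] and x + n is in
  [0,1], then n is one of -2, -1, 0, 1; these four translates give the crude factor 4.\<close>

lemma measure_nu_eta_image:
  assumes "0 \<le> u" "u \<le> v" "v \<le> 2"
  shows "measure nu (eta ` {u..v}) \<le> 4 * (v - u)"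
proof -
  have "{t\<in>{0..1}. eta t \<in> eta ` {u..v}} \<subseteq> (\<Union>n\<in>{-2..1::int}. {u + of_int n..v + of_int n})"
  proof
    fix t assume t: "t \<in> {t\<in>{0..1}. eta t \<in> eta ` {u..v}}"
    then obtain x n where "x \<in> {u..v}" "t = x + of_int n" by (auto simp: eta_eq_iff)
    moreover have "- 2 \<le> n" "n \<le> 1" using calculation t assms by auto
    ultimately show "t \<in> (\<Union>n\<in>{-2..1::int}. {u + of_int n..v + of_int n})"
      by (intro UN_I[of n]) auto
  qed
  then have "emeasure nu (eta ` {u..v}) \<le> emeasure lborel (\<Union>n\<in>{-2..1::int}. {u + of_int n..v + of_int n})"
    by (subst emeasure_nu[OF eta_image_in_sets_nu]) (auto intro!: emeasure_mono)
  also have "\<dots> \<le> (\<Sum>n\<in>{-2..1::int}. emeasure lborel {u + of_int n..v + of_int n})"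
    by (rule emeasure_subadditive_finite) auto
  also have "\<dots> = ennreal (4 * (v - u))"
    using assms by (simp add: ennreal_mult del: right_diff_distrib_numeral)
  finally show ?thesis
    using assms by (simp add: measure_def enn2real_leI)
qed

lemma angle_measurable [measurable]: "angle \<in> borel_measurable (restrict_space borel circle)"
proof (subst borel_measurable_iff_le, intro allI)
  fix a
  have "{z\<in>circle. angle z \<le> a} = eta ` {0..a}" if "a < 1"
  proof (intro equalityI subsetI)
    fix z assume "z \<in> {z\<in>circle. angle z \<le> a}"
    then show "z \<in> eta ` {0..a}"
      using eta_angle[of z] angle_bounds[of z] by (intro image_eqI[of _ _ "angle z"]) auto
  qed (use that in \<open>auto simp: frac_of_unit\<close>)
  moreover have "{z\<in>circle. angle z \<le> a} = circle" if "1 \<le> a"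
    using that angle_bounds(2) by (auto intro: less_imp_le less_le_trans)
  moreover have "circle \<in> sets nu" using sets.top[of nu] by simp
  ultimately have "{z\<in>circle. angle z \<le> a} \<in> sets nu"
    using eta_image_in_sets_nu[of 0 a] by (cases "a < 1") auto
  then show "{w \<in> space (restrict_space borel circle). angle w \<le> a} \<in> sets (restrict_space borel circle)"
    by (simp add: sets_nu space_restrict_space)
qed

text \<open>Countably many integer translates of the unit interval cover the line and
  \<open>eta\<close> is 1-periodic. Working on the whole line makes null sets stable under arbitrary
  nonconstant affine substitutions.\<close>

lemma null_sets_nu_iff:
  assumes N: "N \<in> sets nu"
  shows "N \<in> null_sets nu \<longleftrightarrow> (AE t in lborel. eta t \<notin> N)"
proof -
  have meas [measurable]: "Measurable.pred borel (\<lambda>t. eta t \<notin> N)"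
    using measurable_sets[OF eta_measurable, of N] N by (simp add: sets_nu pred_def vimage_def Compl_eq[symmetric]) 
  have "N \<in> null_sets nu \<longleftrightarrow> emeasure lborel {t\<in>{0..1}. eta t \<in> N} = 0"
    using N by (simp add: null_sets_def emeasure_nu)
  also have "\<dots> \<longleftrightarrow> (AE t in lborel. t \<in> {0..1} \<longrightarrow> eta t \<notin> N)"
  proof -
    have "{t. eta t \<in> N} \<in> sets borel"
      using measurable_sets[OF eta_measurable, of N] N by (simp add: sets_nu vimage_def)
    then have "{0..1} \<inter> {t. eta t \<in> N} \<in> sets borel" by (intro sets.Int) auto
    also have "{0..1} \<inter> {t. eta t \<in> N} = {t\<in>{0..1}. eta t \<in> N}" by auto
    finally show ?thesis
      by (subst AE_iff_measurable[OF _ refl]) auto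
  qed
  also have "\<dots> \<longleftrightarrow> (AE t in lborel. eta t \<notin> N)"
  proof
    assume *: "AE t in lborel. t \<in> {0..1} \<longrightarrow> eta t \<notin> N"
    \<comment> \<open>The factor 1 gives the argument the affine form that
      \<open>AE_borel_affine\<close> expects.\<close>
    have "AE t in lborel. \<forall>n::int. of_int n + 1 * t \<in> {0..1} \<longrightarrow> eta (of_int n + 1 * t) \<notin> N"
      by (subst AE_all_countable, intro allI AE_borel_affine) (use * in auto)
    then show "AE t in lborel. eta t \<notin> N"
    proof eventually_elim
      case (elim t)
      have "of_int (- \<lfloor>t\<rfloor>) + 1 * t = frac t" by (simp add: frac_def)
      then show ?case using elim[rule_format, of "- \<lfloor>t\<rfloor>"] frac_lt_1[of t] by auto
    qed
  qed auto
  finally show ?thesis .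
qed

section \<open>Elements of Thompson's group T\<close>

definition rotation :: "real \<Rightarrow> complex \<Rightarrow> complex" where
  "rotation a = (\<lambda>z\<in>circle. eta a * z)"

text \<open>The map of the circle induced by \<open>\<phi>\<close> on \<open>{0..<1}\<close>, conjugated by the rotation by \<open>a\<close>. For a fixed
  point \<open>p\<close> that is not dyadic, \<open>a\<close> is a dyadic number slightly below the argument of \<open>p\<close>.\<close>

definition circle_lift :: "(real \<Rightarrow> real) \<Rightarrow> real \<Rightarrow> complex \<Rightarrow> complex" where
  "circle_lift \<phi> a = (\<lambda>z\<in>circle. eta (a + \<phi> (frac (angle z - a))))"

text \<open>This lets the lift be evaluated at \<open>eta t\<close> for every real \<open>t\<close>,
  not only for the representative chosen by \<open>angle\<close>.\<close>

lemma frac_frac_diff: "frac (frac t - a) = frac (t - a)"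
proof -
  have eq: "frac t - a = (t - a) - of_int \<lfloor>t\<rfloor>" by (simp add: frac_def)
  then have f: "\<lfloor>frac t - a\<rfloor> = \<lfloor>t - a\<rfloor> - \<lfloor>t\<rfloor>" by (simp only: floor_diff_of_int)
  show ?thesis
    unfolding frac_def[of "frac t - a"] frac_def[of "t - a"] f unfolding eq by simp
qed

lemma circle_lift_eta: "circle_lift \<phi> a (eta t) = eta (a + \<phi> (frac (t - a)))"
  by (simp add: circle_lift_def frac_frac_diff)

lemma circle_lift_closed: "z \<in> circle \<Longrightarrow> circle_lift \<phi> a z \<in> circle"
  by (simp add: circle_lift_def)

lemma circle_lift_inverse:
  assumes "\<And>x. x \<in> {0..<1} \<Longrightarrow> \<phi> x \<in> {0..<1} \<and> \<psi> (\<phi> x) = x" "z \<in> circle"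
  shows "circle_lift \<psi> a (circle_lift \<phi> a z) = z"
proof -
  obtain t where t: "z = eta t" using circle_etaE[OF assms(2)] by metis
  have "frac (t - a) \<in> {0..<1}" by (simp add: frac_lt_1)
  then have "\<phi> (frac (t - a)) \<in> {0..<1}" "\<psi> (\<phi> (frac (t - a))) = frac (t - a)"
    using assms(1) by auto
  then have "frac (\<phi> (frac (t - a))) = \<phi> (frac (t - a))" by (auto simp: frac_of_unit)
  with \<open>\<psi> _ = _\<close> show ?thesis by (simp add: t circle_lift_eta)
qed

lemma circle_lift_Bij:
  assumes "\<And>x. x \<in> {0..<1} \<Longrightarrow> \<phi> x \<in> {0..<1} \<and> \<psi> (\<phi> x) = x"
    and "\<And>x. x \<in> {0..<1} \<Longrightarrow> \<psi> x \<in> {0..<1} \<and> \<phi> (\<psi> x) = x"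
  shows "circle_lift \<phi> a \<in> Bij circle"
proof -
  have "bij_betw (circle_lift \<phi> a) circle circle"
    by (rule bij_betw_byWitness[where f' = "circle_lift \<psi> a"])
      (use circle_lift_inverse[of \<phi> \<psi>] circle_lift_inverse[of \<psi> \<phi>] assms circle_lift_closed in blast)+
  then show ?thesis by (simp add: Bij_def circle_lift_def)
qed

lemma rotation_Bij: "rotation a \<in> Bij circle"
proof -
  have *: "rotation b (rotation c z) = z" if "z \<in> circle" "b + c = 0" for b c z
  proof -
    have "eta b * eta c = 1" using that eta_add[of b c] by (simp add: eta_def)
    then show ?thesis using that by (simp add: rotation_def norm_mult mult.assoc[symmetric])
  qed
  have "bij_betw (rotation a) circle circle"
    by (rule bij_betw_byWitness[where f' = "rotation (- a)"])
      (use * in \<open>auto simp: rotation_def norm_mult\<close>)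
  then show ?thesis by (simp add: Bij_def rotation_def)
qed

lemma circle_R_eq: "circle_R = rotation ` ((\<lambda>a. a / 2) ` dyadic_rationals)"
  by (auto simp: circle_R_def rotation_def eta_eq_cis image_image)

section \<open>Thompson's group and its stabilizers inside the bijections of the circle\<close>

lemma subgroup_thompson_T: "subgroup (carrier thompson_T) (BijGroup circle)"
proof -
  have "circle_F \<union> circle_R \<subseteq> carrier (BijGroup circle)"
    using rotation_Bij by (auto simp: circle_R_eq circle_F_def BijGroup_def)
  then show ?thesis
    unfolding thompson_T_def by (simp add: group.generate_is_subgroup[OF group_BijGroup])
qed

lemma thompson_T_eq: "thompson_T = (BijGroup circle)\<lparr>carrier := carrier thompson_T\<rparr>"
  by (simp add: thompson_T_def)

lemma group_thompson_T: "group thompson_T"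
  by (subst thompson_T_eq) (rule subgroup.subgroup_is_group[OF subgroup_thompson_T group_BijGroup])

lemma thompson_T_Bij: "\<gamma> \<in> carrier thompson_T \<Longrightarrow> \<gamma> \<in> Bij circle"
  using subgroup.mem_carrier[OF subgroup_thompson_T] by (simp add: BijGroup_def)

lemma mult_thompson_T:
  assumes "\<gamma> \<in> carrier thompson_T" "\<beta> \<in> carrier thompson_T"
  shows "\<gamma> \<otimes>\<^bsub>thompson_T\<^esub> \<beta> = compose circle \<gamma> \<beta>"
  using thompson_T_Bij[OF assms(1)] thompson_T_Bij[OF assms(2)]
  by (subst thompson_T_eq) (simp add: BijGroup_def)

lemma inv_thompson_T:
  assumes "\<gamma> \<in> carrier thompson_T"
  shows "inv\<^bsub>thompson_T\<^esub> \<gamma> = (\<lambda>z\<in>circle. inv_into circle \<gamma> z)"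
  using group.m_inv_consistent[OF group_BijGroup subgroup_thompson_T assms]
    inv_BijGroup[OF thompson_T_Bij[OF assms]] thompson_T_eq by simp

lemma one_thompson_T: "\<one>\<^bsub>thompson_T\<^esub> = (\<lambda>z\<in>circle. z)"
  by (subst thompson_T_eq) (simp add: BijGroup_def)

lemma T_stab_eq: "T_stab p = {\<gamma> \<in> carrier thompson_T. \<gamma> p = p}"
  by (simp add: T_stab_def stabilizer_def)

lemma subgroup_T_stab:
  assumes p: "p \<in> circle"
  shows "subgroup (T_stab p) thompson_T"
proof (rule group.subgroupI[OF group_thompson_T])
  interpret group thompson_T by (rule group_thompson_T)
  show "T_stab p \<subseteq> carrier thompson_T" by (auto simp: T_stab_eq)
  show "T_stab p \<noteq> {}"
    using one_closed p by (auto simp: T_stab_eq one_thompson_T intro!: exI[of _ "\<one>\<^bsub>thompson_T\<^esub>"])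
  show "inv\<^bsub>thompson_T\<^esub> \<gamma> \<in> T_stab p" if \<gamma>: "\<gamma> \<in> T_stab p" for \<gamma>
  proof -
    have "inj_on \<gamma> circle" "\<gamma> p = p" "\<gamma> \<in> carrier thompson_T"
      using \<gamma> thompson_T_Bij[of \<gamma>] by (auto simp: T_stab_eq Bij_def bij_betw_def)
    then show ?thesis
      using p inv_into_f_f[of \<gamma> circle p] inv_closed[of \<gamma>] by (simp add: T_stab_eq inv_thompson_T)
  qed
  show "\<gamma> \<otimes>\<^bsub>thompson_T\<^esub> \<beta> \<in> T_stab p" if "\<gamma> \<in> T_stab p" "\<beta> \<in> T_stab p" for \<gamma> \<beta>
    using that p m_closed[of \<gamma> \<beta>] by (auto simp: T_stab_eq mult_thompson_T compose_def)
qed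

text \<open>The lift based at \<open>a\<close> is the lift based at 0, an element of
  \<open>circle_F\<close>, conjugated by a dyadic rotation from \<open>circle_R\<close>.\<close>

lemma circle_lift_thompson_T:
  assumes \<phi>: "restrict \<phi> {0..1} \<in> thompson_F" "\<phi> 0 = 0" "\<phi> 1 = 1"
    and bij: "circle_lift \<phi> 0 \<in> Bij circle"
    and a: "a \<in> dyadic_rationals"
  shows "circle_lift \<phi> a \<in> carrier thompson_T"
proof -
  interpret group thompson_T by (rule group_thompson_T)
  have "circle_lift \<phi> 0 (eta t) = eta (restrict \<phi> {0..1} t)" if "t \<in> {0..1}" for t
  \<comment> \<open>At t = 1 the lift sees the fractional part 0, so the endpoint values and
    \<open>eta 1 = eta 0\<close> are needed to agree with \<phi>.\<close>
  proof (cases "t = 1")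
    case True
    then show ?thesis using \<phi>(2,3) eta_int_add[of 0 1] by (simp add: circle_lift_eta frac_1_eq)
  next
    case False
    then show ?thesis using that by (simp add: circle_lift_eta frac_of_unit)
  qed
  then have "circle_lift \<phi> 0 \<in> circle_F"
    unfolding circle_F_def using bij \<phi>(1) by blast
  moreover have "rotation b \<in> circle_R" if "b \<in> dyadic_rationals" for b
  proof -
    \<comment> \<open>\<open>circle_R\<close> measures angles in multiples of \<pi>,
      \<open>eta\<close> in multiples of 2\<pi>; hence the doubled parameter.\<close>
    have "2 * b \<in> dyadic_rationals" using dyadic_rationals_add[OF that that] by simp
    then show ?thesis unfolding circle_R_eq by (intro image_eqI[of _ _ b] image_eqI[of _ _ "2 * b"]) auto
  qed
  ultimately have mem: "circle_lift \<phi> 0 \<in> carrier thompson_T" "rotation a \<in> carrier thompson_T"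
      "rotation (- a) \<in> carrier thompson_T"
    using a dyadic_rationals_minus[OF a] by (auto simp: thompson_T_def intro: generate.incl)
  have "circle_lift \<phi> a = rotation a \<otimes>\<^bsub>thompson_T\<^esub> (circle_lift \<phi> 0 \<otimes>\<^bsub>thompson_T\<^esub> rotation (- a))"
  proof (rule extensionalityI[of _ circle])
    fix z assume z: "z \<in> circle"
    obtain t where t: "z = eta t" using circle_etaE[OF z] by metis
    have "eta (- a) * eta t = eta (t - a)" using eta_add[of "- a" t] by simp
    then have "rotation (- a) z = eta (t - a)" by (simp add: rotation_def t)
    then show "circle_lift \<phi> a z
        = (rotation a \<otimes>\<^bsub>thompson_T\<^esub> (circle_lift \<phi> 0 \<otimes>\<^bsub>thompson_T\<^esub> rotation (- a))) z"
      using mem m_closed[OF mem(1,3)] z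
      by (simp add: mult_thompson_T compose_def t circle_lift_eta)
        (simp add: rotation_def eta_add)
  next
    show "rotation a \<otimes>\<^bsub>thompson_T\<^esub> (circle_lift \<phi> 0 \<otimes>\<^bsub>thompson_T\<^esub> rotation (- a)) \<in> extensional circle"
      using thompson_T_Bij[OF m_closed[OF mem(2) m_closed[OF mem(1,3)]]] by (rule Bij_imp_extensional)
  qed (simp add: circle_lift_def)
  then show ?thesis using mem by simp
qed

section \<open>Measurability and absolute continuity of the lifted maps\<close>

lemma circle_lift_measurable:
  assumes [measurable]: "\<phi> \<in> borel_measurable borel"
  shows "circle_lift \<phi> a \<in> measurable nu nu"
proof -
  have "(\<lambda>z. eta (a + \<phi> (frac (angle z - a)))) \<in> measurable (restrict_space borel circle) (restrict_space borel circle)"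
    unfolding frac_def by measurable
  then show ?thesis
    unfolding measurable_nu circle_lift_def
    by (subst measurable_cong[where g = "\<lambda>z. eta (a + \<phi> (frac (angle z - a)))"])
      (auto simp: space_restrict_space)
qed

lemma absolutely_continuous_nu_distr:
  assumes meas: "\<gamma> \<in> measurable nu nu"
    and "\<And>N. \<lbrakk>N \<in> sets nu; AE t in lborel. eta t \<notin> N\<rbrakk> \<Longrightarrow> AE t in lborel. \<gamma> (eta t) \<notin> N"
  shows "absolutely_continuous nu (distr nu nu \<gamma>)"
  unfolding absolutely_continuous_def
proof
  fix N assume N: "N \<in> null_sets nu"
  then have sets: "N \<in> sets nu" "\<gamma> -` N \<inter> space nu \<in> sets nu"
    using measurable_sets[OF meas] by auto
  have "AE t in lborel. eta t \<notin> N" using N null_sets_nu_iff[OF sets(1)] by simp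
  then have "AE t in lborel. eta t \<notin> \<gamma> -` N \<inter> space nu" using assms(2)[OF sets(1)] by auto
  then have "\<gamma> -` N \<inter> space nu \<in> null_sets nu" using null_sets_nu_iff[OF sets(2)] by simp
  then show "N \<in> null_sets (distr nu nu \<gamma>)"
    using sets meas by (simp add: null_sets_distr_iff)
qed

text \<open>\<open>C\<close> consists of two arcs of length e = 2^(-k), each of measure at most 4e,
  which explains the constant 8. The remaining conclusions are what the change of variables for
  \<open>rho\<close> requires.\<close>

lemma exists_squeezing_element:
  assumes p: "p \<in> circle" and k: "1 \<le> k"
  obtains \<gamma> C where "\<gamma> \<in> T_stab p" "C \<in> sets nu" "measure nu C \<le> 8 * (1 / 2) ^ k"
    "\<And>z. z \<in> circle \<Longrightarrow> z \<in> C \<or> \<gamma> z \<in> C"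
    "\<gamma> \<in> measurable nu nu" "inv\<^bsub>thompson_T\<^esub> \<gamma> \<in> measurable nu nu"
    "\<And>z. z \<in> circle \<Longrightarrow> (inv\<^bsub>thompson_T\<^esub> \<gamma>) (\<gamma> z) = z"
    "absolutely_continuous nu (distr nu nu \<gamma>)"
proof -
  define e :: real where "e = 1 / 2 ^ k"
  have "(2::real) ^ 1 \<le> 2 ^ k" using k by (intro power_increasing) auto
  then have e: "0 < e" "e \<le> 1/2" by (auto simp: e_def field_simps)
  note breaks = squeeze_breaks[OF e]
  obtain t where t: "0 \<le> t" "t < 1" "p = eta t" using circle_etaE[OF p] by metis
  \<comment> \<open>The largest multiple of e^2 not above \<open>t\<close>: it is dyadic since e is,
    and \<open>p\<close> falls into the part of length e^2 on which the squeezing map is the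
    identity.\<close>
  define a where "a = of_int \<lfloor>t / e\<^sup>2\<rfloor> * e\<^sup>2"
  have "e \<in> dyadic_rationals" unfolding e_def by (rule dyadic_rationals_half_power)
  then have a_dyadic: "a \<in> dyadic_rationals"
    unfolding a_def power2_eq_square by (intro dyadic_rationals_mult) auto
  have a: "a \<le> t" "t < a + e\<^sup>2" "0 \<le> a"
  proof -
    have "of_int \<lfloor>t / e\<^sup>2\<rfloor> \<le> t / e\<^sup>2" "t / e\<^sup>2 < of_int \<lfloor>t / e\<^sup>2\<rfloor> + 1" by linarith+
    then have "of_int \<lfloor>t / e\<^sup>2\<rfloor> * e\<^sup>2 \<le> t" "t < (of_int \<lfloor>t / e\<^sup>2\<rfloor> + 1) * e\<^sup>2"
      using breaks(1) by (simp_all only: pos_le_divide_eq pos_divide_less_eq)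
    then show "a \<le> t" "t < a + e\<^sup>2" "0 \<le> a"
      using e t by (auto simp: a_def algebra_simps)
  qed
  let ?\<gamma> = "circle_lift (squeeze e) a" and ?\<gamma>' = "circle_lift (unsqueeze e) a"
  \<comment> \<open>The arcs on either side of the base point \<open>a\<close>. Their complement has
    relative angle strictly between e and 1 - e, hence lies in the piece of slope e, and the first
    arc contains the image of that piece.\<close>
  let ?C = "eta ` {a..a + e} \<union> eta ` {a + 1 - e..a + 1}"
  have sq: "squeeze e x \<in> {0..<1}" if "x \<in> {0..<1}" for x
    using that squeeze_le_iff[OF e, of 0 x] squeeze_less[OF e, of x 1]
    by (simp add: squeeze_0[OF e] squeeze_1[OF e])
  have unsq: "unsqueeze e x \<in> {0..<1}" if "x \<in> {0..<1}" for x
    using that squeeze_le_iff[OF e, of 0 "unsqueeze e x"] squeeze_less_iff[OF e, of "unsqueeze e x" 1]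
    by (simp add: squeeze_0[OF e] squeeze_1[OF e] squeeze_unsqueeze[OF e])
  have bij: "circle_lift (squeeze e) b \<in> Bij circle" for b
    by (rule circle_lift_Bij[of _ "unsqueeze e"])
      (auto simp: unsqueeze_squeeze[OF e] squeeze_unsqueeze[OF e] simp del: atLeastLessThan_iff intro: sq unsq)
  have \<gamma>: "?\<gamma> \<in> carrier thompson_T"
    using squeeze_in_thompson_F[OF k] a_dyadic bij
    by (intro circle_lift_thompson_T) (simp_all add: squeeze_0[OF e] squeeze_1[OF e] e_def[symmetric])
  have "?\<gamma> p = p"
  proof -
    have "frac (t - a) = t - a" using a breaks by (intro frac_of_unit) auto
    then show ?thesis using a by (simp add: t(3) circle_lift_eta squeeze_left[OF e])
  qed
  with \<gamma> have "?\<gamma> \<in> T_stab p" by (simp add: T_stab_eq)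
  moreover have "?C \<in> sets nu" by (intro sets.Un eta_image_in_sets_nu)
  moreover have "measure nu ?C \<le> 8 * (1 / 2) ^ k"
  proof -
    have "a < 1" using a t by simp
    then have "measure nu (eta ` {a..a + e}) \<le> 4 * e" "measure nu (eta ` {a + 1 - e..a + 1}) \<le> 4 * e"
      using a breaks e measure_nu_eta_image[of a "a + e"] measure_nu_eta_image[of "a + 1 - e" "a + 1"]
      by auto
    moreover have "measure nu ?C \<le> measure nu (eta ` {a..a + e}) + measure nu (eta ` {a + 1 - e..a + 1})"
      by (intro measure_Un_le eta_image_in_sets_nu)
    ultimately show ?thesis by (simp add: e_def power_one_over)
  qed
  moreover have "z \<in> ?C \<or> ?\<gamma> z \<in> ?C" if z: "z \<in> circle" for z
  proof -
    obtain u where u: "z = eta u" using circle_etaE[OF z] by metis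
    define x where "x = frac (u - a)"
    have x: "0 \<le> x" "x < 1" by (simp_all add: x_def frac_lt_1)
    have zx: "z = eta (a + x)" by (simp add: x_def u)
    consider "x \<le> e" | "1 - e \<le> x" | "e\<^sup>2 \<le> x" "x \<le> 1 - e + e\<^sup>2" using breaks by linarith
    then show ?thesis
    proof cases
      case 3
      have "squeeze e x \<le> squeeze e (1 - e + e\<^sup>2)" "squeeze e 0 \<le> squeeze e x"
        using 3 x by (simp_all add: squeeze_le_iff[OF e])
      then have "squeeze e x \<in> {0..e}"
        using breaks e squeeze_right_eq[OF e, of "1 - e + e\<^sup>2"]
        by (simp add: squeeze_0[OF e] squeeze_right[OF e])
      then have "?\<gamma> z \<in> eta ` {a..a + e}"
        by (simp add: u circle_lift_eta x_def[symmetric])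
      then show ?thesis by blast
    qed (use zx x in auto)
  qed
  moreover have meas: "squeeze e \<in> borel_measurable borel" "unsqueeze e \<in> borel_measurable borel"
    unfolding squeeze_def[abs_def] unsqueeze_def[abs_def] by measurable
  then have m: "?\<gamma> \<in> measurable nu nu" "?\<gamma>' \<in> measurable nu nu" by (auto intro: circle_lift_measurable)
  \<comment> \<open>The group inverse is defined by choice through \<open>inv_into\<close>;
    identifying it with an explicit lift gives its measurability.\<close>
  moreover have inv: "inv\<^bsub>thompson_T\<^esub> ?\<gamma> = ?\<gamma>'"
  proof (rule extensionalityI[of _ circle])
    fix z assume z: "z \<in> circle"
    have "inv_into circle ?\<gamma> (?\<gamma> (?\<gamma>' z)) = ?\<gamma>' z"
      using bij[of a] circle_lift_closed[OF z] by (intro inv_into_f_f) (auto simp: Bij_def bij_betw_def)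
    moreover have "?\<gamma> (?\<gamma>' z) = z"
      by (rule circle_lift_inverse[OF _ z]) (use unsq squeeze_unsqueeze[OF e] in auto)
    ultimately show "(inv\<^bsub>thompson_T\<^esub> ?\<gamma>) z = ?\<gamma>' z" using z by (simp add: inv_thompson_T[OF \<gamma>])
  qed (simp add: inv_thompson_T[OF \<gamma>], simp add: circle_lift_def)
  moreover have "?\<gamma>' (?\<gamma> z) = z" if "z \<in> circle" for z
    by (rule circle_lift_inverse[OF _ that]) (use sq unsqueeze_squeeze[OF e] in auto)
  moreover have "absolutely_continuous nu (distr nu nu ?\<gamma>)"
  proof (rule absolutely_continuous_nu_distr[OF m(1)])
    fix N assume N: "N \<in> sets nu" "AE t in lborel. eta t \<notin> N"
    have pred: "Measurable.pred borel (\<lambda>t. eta t \<notin> N)"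
      using measurable_sets[OF eta_measurable, of N] N(1)
      by (simp add: sets_nu pred_def vimage_def Compl_eq[symmetric])
    \<comment> \<open>On each piece the image angle is an affine function of \<open>t\<close> that
      also depends on the integer part n of t - a. The two constants below come from substituting t
      - a - n into the pieces of slope e and 1/e; quantifying over all n keeps the exceptional set
      null.\<close>
    note affine = AE_borel_affine[OF _ pred N(2)]
    have "AE t in lborel. \<forall>n::int. eta ((a + e\<^sup>2 - e * (a + n + e\<^sup>2)) + e * t) \<notin> N"
      using e by (subst AE_all_countable) (intro allI affine, simp)
    moreover have "AE t in lborel. \<forall>n::int. eta ((a + 1 - (1 + a + n) / e) + 1 / e * t) \<notin> N"
      using e by (subst AE_all_countable) (intro allI affine, simp)
    ultimately show "AE t in lborel. ?\<gamma> (eta t) \<notin> N"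
      using N(2)
    proof eventually_elim
      case (elim t)
      define n where "n = \<lfloor>t - a\<rfloor>"
      have x: "frac (t - a) = t - a - n" by (simp add: frac_def n_def)
      have "a + (t - a - of_int n) = t + of_int (- n)" by simp
      then have 1: "eta (a + (t - a - of_int n)) \<notin> N" using elim(3) eta_int_add[of t "- n"] by simp
      have "a + (e\<^sup>2 + e * (t - a - of_int n - e\<^sup>2)) = (a + e\<^sup>2 - e * (a + n + e\<^sup>2)) + e * t"
        by (simp add: algebra_simps)
      then have 2: "eta (a + (e\<^sup>2 + e * (t - a - of_int n - e\<^sup>2))) \<notin> N" using elim(1) by metis
      have "a + (1 - (1 - (t - a - of_int n)) / e) = (a + 1 - (1 + a + n) / e) + 1 / e * t"
        by (simp add: diff_divide_distrib add_divide_distrib)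
      then have 3: "eta (a + (1 - (1 - (t - a - of_int n)) / e)) \<notin> N" using elim(2) by metis
      show ?case
        using squeeze_cases[OF e, of "t - a - of_int n"] 1 2 3 by (auto simp: circle_lift_eta x)
    qed
  qed
  ultimately show thesis using that[of ?\<gamma> ?C] by metis
qed

section \<open>Inequivalence\<close>

lemma square_integrable_sum:
  assumes "\<And>i. i \<in> I \<Longrightarrow> f i \<in> square_integrable M"
  shows "(\<lambda>x. \<Sum>i\<in>I. f i x) \<in> square_integrable M"
  using assms
  by (induction I rule: infinite_finite_induct) (auto simp: square_integrable_zero intro: square_integrable_add)

lemma square_integrable_cmod:
  assumes "f \<in> square_integrable M"
  shows "(\<lambda>x. complex_of_real (cmod (f x))) \<in> square_integrable M"
  using assms by (auto simp: square_integrable_def)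

text \<open>Splitting off the zero base reduces measurability of the density factor to that of the
  real logarithm and the exponential.\<close>

lemma of_real_powr_eq_exp_ln:
  "0 \<le> x \<Longrightarrow> complex_of_real x powr w = (if x = 0 then 0 else exp (w * of_real (ln x)))"
  by (simp add: powr_def Ln_of_real)

text \<open>\<open>rho\<close> is a union of classes over all representatives. Once the candidate is
  square integrable, it lies in its own class and hence in the union, so it agrees with
  \<open>g\<close> almost everywhere. Without that its class would be empty.\<close>

lemma rho_representative:
  assumes \<gamma> [measurable]: "\<gamma> \<in> measurable nu nu"
    and \<gamma>' [measurable]: "inv\<^bsub>thompson_T\<^esub> \<gamma> \<in> measurable nu nu"
    and inv: "\<And>z. z \<in> circle \<Longrightarrow> (inv\<^bsub>thompson_T\<^esub> \<gamma>) (\<gamma> z) = z"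
    and ac: "absolutely_continuous nu (distr nu nu \<gamma>)"
    and f: "f \<in> square_integrable nu" and g: "g \<in> square_integrable nu"
    and eq: "rho s \<gamma> (L2_class nu f) = L2_class nu g"
  shows "AE z in nu. g z = of_real (enn2real (RN_deriv nu (distr nu nu \<gamma>) z)) powr Complex (1/2) s
            * f ((inv\<^bsub>thompson_T\<^esub> \<gamma>) z)"
proof -
  interpret finite_measure nu by (rule finite_measure_nu)
  let ?D = "\<lambda>z. of_real (enn2real (RN_deriv nu (distr nu nu \<gamma>) z)) powr Complex (1/2) s
            * f ((inv\<^bsub>thompson_T\<^esub> \<gamma>) z)"
  have [measurable]: "f \<in> borel_measurable nu" using f by (simp add: square_integrable_def)
  have [measurable]: "?D \<in> borel_measurable nu"
    by (simp add: of_real_powr_eq_exp_ln)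
  have "(\<integral>\<^sup>+z. ennreal ((cmod (?D z))\<^sup>2) \<partial>nu)
      = (\<integral>\<^sup>+z. ennreal ((cmod (?D z))\<^sup>2) * indicator (space nu) z \<partial>nu)"
    by (rule nn_integral_cong) simp
  also have "\<dots> = (\<integral>\<^sup>+x. ennreal ((cmod (f x))\<^sup>2) * indicator (space nu) (\<gamma> x) \<partial>nu)"
    by (rule nn_integral_weighted_composition) (use inv ac sets.top[of nu] in auto)
  also have "\<dots> \<le> (\<integral>\<^sup>+x. ennreal ((cmod (f x))\<^sup>2) \<partial>nu)"
    by (rule nn_integral_mono) (simp add: indicator_def)
  also have "\<dots> < \<infinity>"
    using f by (simp add: square_integrable_def integrable_iff_bounded)
  finally have D: "?D \<in> square_integrable nu"
    by (simp add: square_integrable_def integrable_iff_bounded)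
  have "?D \<in> rho s \<gamma> (L2_class nu f)"
    using L2_class_self[OF D] L2_class_self[OF f] L2_class_in_carrier[OF f]
    by (auto simp: rho_def simp del: Image_singleton_iff)
  then show ?thesis unfolding eq by (simp add: ae_eq_def)
qed

theorem mainTheorem6:
  fixes p :: complex
    and V :: "'v inner_module"
    and \<sigma> :: "(complex \<Rightarrow> complex) \<Rightarrow> 'v \<Rightarrow> 'v"
    and s :: real
  assumes "p \<in> circle"
    and "unitary_rep (thompson_T\<lparr>carrier := T_stab p\<rparr>) V \<sigma>"
    and "finite_dimensional V"
  shows "\<not> unitarily_equivalent thompson_T
           (induced_space thompson_T (T_stab p) V \<sigma>)
           (induced_rep thompson_T (T_stab p) V \<sigma>)
           (L2_space nu) (rho s)"
proof
  assume equiv: "unitarily_equivalent thompson_T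
           (induced_space thompson_T (T_stab p) V \<sigma>)
           (induced_rep thompson_T (T_stab p) V \<sigma>)
           (L2_space nu) (rho s)"
  interpret nu: finite_measure nu by (rule finite_measure_nu)
  interpret hilb: complex_hilbert_space V using assms(2) by (simp add: unitary_rep_def)
  interpret ind: induced_representation thompson_T V "T_stab p" \<sigma>
    by (intro induced_representation.intro group_thompson_T hilb.complex_hilbert_space_axioms
        induced_representation_axioms.intro subgroup_T_stab assms(1))
      (use assms(2) in \<open>simp add: unitary_rep_def\<close>)
  obtain U where U: "U \<in> unitary_maps ind.Ind (L2_space nu)"
    and twine: "\<And>g v. \<lbrakk>g \<in> carrier thompson_T; v \<in> carrier ind.Ind\<rbrakk>
       \<Longrightarrow> U (induced_rep thompson_T (T_stab p) V \<sigma> g v) = rho s g (U v)"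
    using equiv unfolding unitarily_equivalent_def by blast
  \<comment> \<open>\<open>J\<close> is a linear isometric embedding of \<open>V\<close> into L2
    that intertwines \<sigma> with the restriction of \<open>rho s\<close> to the stabilizer of
    \<open>p\<close>.\<close>
  define J where "J v = U (ind.\<delta> v)" for v
  have J_closed: "J v \<in> carrier (L2_space nu)" if "v \<in> carrier V" for v
    unfolding J_def by (rule unitary_mapsD(1)[OF U ind.delta_in_carrier[OF that]])
  have J_add: "J (v \<oplus>\<^bsub>V\<^esub> w) = J v \<oplus>\<^bsub>L2_space nu\<^esub> J w" if "v \<in> carrier V" "w \<in> carrier V" for v w
    unfolding J_def ind.delta_add[OF that]
    by (rule unitary_mapsD(2)[OF U that[THEN ind.delta_in_carrier]])
  have J_smult: "J (c \<odot>\<^bsub>V\<^esub> v) = c \<odot>\<^bsub>L2_space nu\<^esub> J v" if "v \<in> carrier V" for c v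
    unfolding J_def ind.delta_smult[OF that]
    by (rule unitary_mapsD(3)[OF U ind.delta_in_carrier[OF that]])
  have J_ip: "ip (L2_space nu) (J v) (J v) = ip V v v" if "v \<in> carrier V" for v
    unfolding J_def unitary_mapsD(4)[OF U ind.delta_in_carrier[OF that] ind.delta_in_carrier[OF that]]
    by (rule ind.ip_delta[OF that that])
  have J_rho: "J (\<sigma> h v) = rho s h (J v)" if "h \<in> T_stab p" "v \<in> carrier V" for h v
    using twine[OF ind.H_carrier[OF that(1)] ind.delta_in_carrier[OF that(2)]]
    unfolding ind.induced_rep_delta[OF that(2,1)] J_def .
  have "\<exists>f. f \<in> square_integrable nu \<and> J v = L2_class nu f" if "v \<in> carrier V" for v
    using J_closed[OF that] by (auto elim: L2_carrierE)
  \<comment> \<open>One representative per vector is fixed here. \<open>R\<close> need not be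
    linear; linear relations hold only between classes, as in \<open>J_finsum\<close>.\<close>
  then obtain R where R: "\<And>v. v \<in> carrier V \<Longrightarrow> R v \<in> square_integrable nu"
    and JR: "\<And>v. v \<in> carrier V \<Longrightarrow> J v = L2_class nu (R v)"
    by metis
  have J_finsum: "J (\<Oplus>\<^bsub>V\<^esub>e\<in>E. c e \<odot>\<^bsub>V\<^esub> e) = L2_class nu (\<lambda>x. \<Sum>e\<in>E. c e * R e x)"
    if "finite E" "E \<subseteq> carrier V" for E c
    using that
  proof (induction E rule: finite_induct)
    case empty
    have "J \<zero>\<^bsub>V\<^esub> = J (0 \<odot>\<^bsub>V\<^esub> \<zero>\<^bsub>V\<^esub>)" by simp
    also have "\<dots> = L2_class nu (\<lambda>x. 0 * R \<zero>\<^bsub>V\<^esub> x)"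
      by (simp only: J_smult JR hilb.M.zero_closed L2_smult R)
    finally show ?case by simp
  next
    case (insert e E)
    have *: "(\<lambda>x. c d * R d x) \<in> square_integrable nu" if "d \<in> insert e E" for d
      using insert.prems that by (intro square_integrable_mult_left R) auto
    have e: "e \<in> carrier V" and E: "E \<subseteq> carrier V" using insert.prems by auto
    have "(\<Oplus>\<^bsub>V\<^esub>d\<in>insert e E. c d \<odot>\<^bsub>V\<^esub> d) = c e \<odot>\<^bsub>V\<^esub> e \<oplus>\<^bsub>V\<^esub> (\<Oplus>\<^bsub>V\<^esub>d\<in>E. c d \<odot>\<^bsub>V\<^esub> d)"
      using insert by (intro hilb.M.finsum_insert) auto
    moreover have "(\<Oplus>\<^bsub>V\<^esub>d\<in>E. c d \<odot>\<^bsub>V\<^esub> d) \<in> carrier V"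
      using E by (intro hilb.M.finsum_closed) auto
    moreover have "J (c e \<odot>\<^bsub>V\<^esub> e) = L2_class nu (\<lambda>x. c e * R e x)"
      using e by (simp only: J_smult JR L2_smult R)
    ultimately have "J (\<Oplus>\<^bsub>V\<^esub>d\<in>insert e E. c d \<odot>\<^bsub>V\<^esub> d)
        = L2_class nu (\<lambda>x. c e * R e x) \<oplus>\<^bsub>L2_space nu\<^esub> L2_class nu (\<lambda>x. \<Sum>d\<in>E. c d * R d x)"
      using e insert.IH[OF E] by (simp only: J_add hilb.smult_complex_closed)
    also have "\<dots> = L2_class nu (\<lambda>x. c e * R e x + (\<Sum>d\<in>E. c d * R d x))"
      by (intro L2_add square_integrable_sum *) auto
    finally show ?case using insert.hyps by simp
  qed
  \<comment> \<open>If \<open>V\<close> were zero, every vector of the induced space would have norm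
    0, but by surjectivity of \<open>U\<close> one of them maps to the constant 1, whose norm is
    1.\<close>
  obtain v where v: "v \<in> carrier V" "v \<noteq> \<zero>\<^bsub>V\<^esub>"
  proof (rule ccontr)
    assume "\<not> thesis"
    then have V0: "carrier V \<subseteq> {\<zero>\<^bsub>V\<^esub>}" using that by blast
    have one: "(\<lambda>z. 1) \<in> square_integrable nu" by (simp add: square_integrable_def)
    obtain f where f: "f \<in> carrier ind.Ind" "U f = L2_class nu (\<lambda>z. 1)"
      using unitary_maps_surj[OF U L2_class_in_carrier[OF one]] ..
    have "f (coset_rep C) = \<zero>\<^bsub>V\<^esub>" if "C \<in> lcosets\<^bsub>thompson_T\<^esub> (T_stab p)" for C
      using f(1) ind.coset_rep_carrier[OF that] V0 by (auto simp: induced_space_def)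
    then have "ip ind.Ind f f = 0"
      by (simp add: induced_space_def infsum_0)
    then have "ip (L2_space nu) (L2_class nu (\<lambda>z. 1)) (L2_class nu (\<lambda>z. 1)) = 0"
      using unitary_mapsD(4)[OF U f(1) f(1)] f(2) by simp
    then have "measure nu circle = 0" by (simp add: L2_ip_self[OF one] del: Image_singleton_iff)
    moreover have "emeasure nu circle = 1"
      using emeasure_nu[OF sets.top] by (simp flip: atLeastAtMost_def atLeastAtMost_iff)
    ultimately show False by (simp add: measure_def)
  qed
  define f where "f = R v"
  have f: "f \<in> square_integrable nu" "f \<in> borel_measurable nu"
    using R[OF v(1)] by (auto simp: f_def square_integrable_def)
  have norm_f: "(\<integral>\<^sup>+x. ennreal ((cmod (f x))\<^sup>2) \<partial>nu) = ennreal ((ip_norm V v)\<^sup>2)"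
  proof -
    have "complex_of_real (LINT x|nu. (cmod (f x))\<^sup>2) = complex_of_real ((ip_norm V v)\<^sup>2)"
      using J_ip[OF v(1)] by (simp only: JR[OF v(1)] L2_ip_self R[OF v(1)] hilb.ip_self[OF v(1)] f_def)
    then have "(LINT x|nu. (cmod (f x))\<^sup>2) = (ip_norm V v)\<^sup>2" by (simp only: of_real_eq_iff)
    then show ?thesis
      using f by (subst nn_integral_eq_integral) (auto simp: square_integrable_def)
  qed
  obtain E where E: "finite E" "hilb.orthonormal E"
    and expand: "\<And>w. w \<in> carrier V \<Longrightarrow> hilb.expansion E w = w"
    using hilb.finite_orthonormal_basis[OF assms(3)] by metis
  have EV: "E \<subseteq> carrier V" using E(2) by (simp add: hilb.orthonormal_def)
  \<comment> \<open>For every \<gamma> the vector \<open>\<sigma> \<gamma> v\<close> has the norm of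
    \<open>v\<close>, which bounds each of its coordinates; so this finite sum dominates all its
    representatives, with no reference to \<gamma>.\<close>
  define G where "G x = (\<Sum>e\<in>E. of_real (ip_norm V v) * complex_of_real (cmod (R e x)))" for x
  have G: "G \<in> square_integrable nu"
    unfolding G_def[abs_def] using EV
    by (intro square_integrable_sum square_integrable_mult_left square_integrable_cmod R) auto
  note [measurable] = f(2)
  have [measurable]: "G \<in> borel_measurable nu" using G by (simp add: square_integrable_def)
  define h where "h x = ennreal ((cmod (f x))\<^sup>2) + ennreal ((cmod (G x))\<^sup>2)" for x
  have h_meas [measurable]: "h \<in> borel_measurable nu"
    unfolding h_def[abs_def] by measurable
  have "(\<integral>\<^sup>+x. h x \<partial>nu) = (\<integral>\<^sup>+x. ennreal ((cmod (f x))\<^sup>2) \<partial>nu) + (\<integral>\<^sup>+x. ennreal ((cmod (G x))\<^sup>2) \<partial>nu)"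
    unfolding h_def by (intro nn_integral_add) measurable
  then have h_fin: "(\<integral>\<^sup>+x. h x \<partial>nu) < \<infinity>"
    using f G by (simp add: square_integrable_def integrable_iff_bounded)
  \<comment> \<open>The squeezing elements require a positive exponent (e at most 1/2), hence
    \<open>Suc n\<close>.\<close>
  have bound: "\<exists>C. C \<in> sets nu \<and> measure nu C \<le> 8 * (1 / 2) ^ Suc n \<and>
      ennreal ((ip_norm V v)\<^sup>2) \<le> (\<integral>\<^sup>+x. h x * indicator C x \<partial>nu)" for n
  proof -
    obtain \<gamma> C where \<gamma>: "\<gamma> \<in> T_stab p" and C [measurable]: "C \<in> sets nu"
      and small: "measure nu C \<le> 8 * (1 / 2) ^ Suc n"
      and cover: "\<And>z. z \<in> circle \<Longrightarrow> z \<in> C \<or> \<gamma> z \<in> C"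
      and m: "\<gamma> \<in> measurable nu nu" "inv\<^bsub>thompson_T\<^esub> \<gamma> \<in> measurable nu nu"
      and inv: "\<And>z. z \<in> circle \<Longrightarrow> (inv\<^bsub>thompson_T\<^esub> \<gamma>) (\<gamma> z) = z"
      and ac: "absolutely_continuous nu (distr nu nu \<gamma>)"
      using exists_squeezing_element[OF assms(1), of "Suc n"] by auto
    note [measurable] = m(1)
    let ?D = "\<lambda>z. of_real (enn2real (RN_deriv nu (distr nu nu \<gamma>) z)) powr Complex (1/2) s
            * f ((inv\<^bsub>thompson_T\<^esub> \<gamma>) z)"
    define w where "w = \<sigma> \<gamma> v"
    have w: "w \<in> carrier V" "ip_norm V w = ip_norm V v"
      using \<gamma> v(1) unitary_mapsD(4)[OF ind.unitary[OF \<gamma>] v(1) v(1)] by (auto simp: w_def ip_norm_def)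
    let ?g = "\<lambda>x. \<Sum>e\<in>E. ip V w e * R e x"
    have g: "?g \<in> square_integrable nu"
      using EV by (intro square_integrable_sum square_integrable_mult_left R) auto
    have "rho s \<gamma> (L2_class nu f) = J w"
      using J_rho[OF \<gamma> v(1)] by (simp only: JR[OF v(1)] f_def w_def)
    also have "\<dots> = L2_class nu ?g"
      using J_finsum[OF E(1) EV, of "ip V w"] expand[OF w(1)] by (simp only: hilb.expansion_def)
    finally have eq: "rho s \<gamma> (L2_class nu f) = L2_class nu ?g" .
    \<comment> \<open>The exceptional null set may depend on \<gamma>; this is harmless because only
      integrals are compared.\<close>
    have "AE z in nu. ?g z = ?D z"
      by (rule rho_representative[OF m inv ac f(1) g eq])
    then have D_le: "AE z in nu. ennreal ((cmod (?D z))\<^sup>2) * indicator C z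
        \<le> ennreal ((cmod (G z))\<^sup>2) * indicator C z"
    proof eventually_elim
      case (elim z)
      have "cmod (?g z) \<le> (\<Sum>e\<in>E. ip_norm V v * cmod (R e z))"
      proof (rule sum_norm_le)
        fix e assume "e \<in> E"
        then have "cmod (ip V w e) \<le> ip_norm V v"
          using hilb.cmod_ip_le[of w e] w E(2) by (auto simp: hilb.orthonormal_def)
        then show "cmod (ip V w e * R e z) \<le> ip_norm V v * cmod (R e z)"
          by (simp add: norm_mult mult_right_mono)
      qed
      also have "\<dots> = cmod (G z)"
      proof -
        have "G z = of_real (\<Sum>e\<in>E. ip_norm V v * cmod (R e z))" by (simp add: G_def)
        moreover have "0 \<le> (\<Sum>e\<in>E. ip_norm V v * cmod (R e z))"
          using hilb.ip_norm_pos[OF v] by (intro sum_nonneg) auto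
        ultimately show ?thesis by (simp only: norm_of_real abs_of_nonneg)
      qed
      finally have "(cmod (?D z))\<^sup>2 \<le> (cmod (G z))\<^sup>2" unfolding elim by (intro power_mono) auto
      then show ?case by (intro mult_right_mono ennreal_leI) auto
    qed
    \<comment> \<open>Every point lies in \<open>C\<close> or is moved into \<open>C\<close>, so the
      two indicators together cover the whole mass of \<bar>f\<bar>^2.\<close>
    have "ennreal ((ip_norm V v)\<^sup>2) \<le> (\<integral>\<^sup>+x. ennreal ((cmod (f x))\<^sup>2) * indicator C x
        + ennreal ((cmod (f x))\<^sup>2) * indicator C (\<gamma> x) \<partial>nu)"
      unfolding norm_f[symmetric]
    proof (rule nn_integral_mono)
      fix x assume "x \<in> space nu"
      then have "x \<in> C \<or> \<gamma> x \<in> C" using cover by simp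
      then show "ennreal ((cmod (f x))\<^sup>2) \<le> ennreal ((cmod (f x))\<^sup>2) * indicator C x
        + ennreal ((cmod (f x))\<^sup>2) * indicator C (\<gamma> x)"
        by (auto simp: indicator_def)
    qed
    also have "\<dots> = (\<integral>\<^sup>+x. ennreal ((cmod (f x))\<^sup>2) * indicator C x \<partial>nu)
        + (\<integral>\<^sup>+x. ennreal ((cmod (f x))\<^sup>2) * indicator C (\<gamma> x) \<partial>nu)"
      by (intro nn_integral_add) measurable
    \<comment> \<open>The mass moved into \<open>C\<close> is the mass that the translate
      \<open>?D\<close> has on \<open>C\<close>, where \<open>G\<close> controls it.\<close>
    also have "(\<integral>\<^sup>+x. ennreal ((cmod (f x))\<^sup>2) * indicator C (\<gamma> x) \<partial>nu)
        = (\<integral>\<^sup>+z. ennreal ((cmod (?D z))\<^sup>2) * indicator C z \<partial>nu)"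
      by (rule nu.nn_integral_weighted_composition[symmetric]) (use m inv ac f C in auto)
    also have "\<dots> \<le> (\<integral>\<^sup>+z. ennreal ((cmod (G z))\<^sup>2) * indicator C z \<partial>nu)"
      by (rule nn_integral_mono_AE[OF D_le])
    also have "(\<integral>\<^sup>+x. ennreal ((cmod (f x))\<^sup>2) * indicator C x \<partial>nu)
        + (\<integral>\<^sup>+z. ennreal ((cmod (G z))\<^sup>2) * indicator C z \<partial>nu)
        = (\<integral>\<^sup>+x. h x * indicator C x \<partial>nu)"
      unfolding h_def distrib_right
      by (intro nn_integral_add[symmetric]) measurable
    finally have "ennreal ((ip_norm V v)\<^sup>2) \<le> (\<integral>\<^sup>+x. h x * indicator C x \<partial>nu)"
      by (simp add: add_left_mono)
    with C small show ?thesis by blast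
  qed
  then obtain C where C: "\<And>n. C n \<in> sets nu" "\<And>n. measure nu (C n) \<le> 8 * (1 / 2) ^ Suc n"
    "\<And>n. ennreal ((ip_norm V v)\<^sup>2) \<le> (\<integral>\<^sup>+x. h x * indicator (C n) x \<partial>nu)"
    by metis
  have "summable (\<lambda>n. 8 * (1 / 2 :: real) ^ Suc n)"
    by (intro summable_mult summable_Suc_iff[THEN iffD2] summable_geometric) simp
  then have "summable (\<lambda>n. measure nu (C n))"
    by (rule summable_comparison_test_ev[rotated]) (use C(2) in simp)
  then have "(\<lambda>n. \<integral>\<^sup>+x. h x * indicator (C n) x \<partial>nu) \<longlonglongrightarrow> 0"
    by (intro nu.nn_integral_shrinking_sets h_meas h_fin C(1))
  then have "ennreal ((ip_norm V v)\<^sup>2) \<le> 0"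
    by (rule LIMSEQ_le_const) (use C(3) in auto)
  then show False using hilb.ip_norm_pos[OF v] by (simp add: ennreal_eq_0_iff)
qed

end
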